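(* Let $F\in US(\mathbb{R})$ be a universal symbol, and let $$m_F=\Bigl\{x\in\mathbb{R}:\ |F(x)|=\inf_{t\in\mathbb{R}}|F(t)|\Bigr\}.$$ Then the set $m_F$ is connected. If $m_F\neq\mathbb{R}$ and $U$ is a connected component of $\mathbb{R}\setminus m_F$, then $|F|$ is strictly monotone and unbounded on $U$.
   Context: The empty set is regarded as connected. **Hermitian elements.** A complex unital Banach algebra $\mathcal{A}$ is a complex Banach space that is also an algebra with unit $\mathbf{1}_{\mathcal{A}}$, $\|\mathbf{1}_{\mathcal{A}}\|=1$, and $\|ab\|\le\|a\|\,\|b\|$ for all $a,b\in\mathcal{A}$ (not assumed commutative). For $a\in\mathcal{A}$, $\sigma(a)$ is its spectrum and $|a|=\max\{|\lambda|:\lambda\in\sigma(a)\}$ its spectral radius. An element $a$ is Hermitian if its numerical range $V(a)=\{\varphi(a):\varphi\in\mathcal{A}^*,\ \varphi(\mathbf{1}_{\mathcal{A}})=\|\varphi\|=1\}$ is contained in $\mathbb{R}$; equivalently, $\|\exp(ita)\|=1$ for all $t\in\mathbb{R}$. $H(\mathcal{A})$ denotes the set of Hermitian elements; for $a\in H(\mathcal{A})$ one has $\sigma(a)\subset V(a)\subset\mathbb{R}$. **Symbols and functional calculus.** $M(\mathbb{R})$ is the Banach algebra (under convolution and total variation norm) of finite complex Borel measures on $\mathbb{R}$; $\hat\mu(\xi)=\int_{\mathbb{R}}e^{i\xi x}\,d\mu(x)$; $B(\mathbb{R})=\{\hat\mu:\mu\in M(\mathbb{R})\}$. $B_{loc}(\mathbb{R})$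 is the algebra of all functions $F:\mathbb{R}\to\mathbb{C}$ that belong locally to $B(\mathbb{R})$ (every point has a neighborhood on which $F$ coincides with an element of $B(\mathbb{R})$; equivalently, on a neighborhood of every compact set $F$ coincides with an element of $B(\mathbb{R})$). Elements of $B_{loc}(\mathbb{R})$ are called symbols. For a symbol $F$ and $a\in H(\mathcal{A})$, choose $\mu\in M(\mathbb{R})$ with $F=\hat\mu$ in a real neighborhood of $\sigma(a)$ and set $F(a)=\int_{\mathbb{R}}\exp(ita)\,d\mu(t)$; this does not depend on the choice of $\mu$. **Universal symbols.** $US(\mathbb{R})$ is the set of symbols $F\in B_{loc}(\mathbb{R})$ that are universal, i.e. $\|F(a)\|=|F(a)|$ (norm equals spectral radius) for each complex unital Banach algebra $\mathcal{A}$ and all $a\in H(\mathcal{A})$. *)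

theory Defs
  imports "HOL-Algebra.Module" "HOL-Analysis.Analysis"
begin

section \<open>Complex measures on the real line\<close>

text \<open>A finite complex Borel measure is a countably additive complex-valued set function on the
  Borel sets (its values on other sets are irrelevant). Taking all \<open>A n\<close> empty gives
  \<open>\<mu> {} = 0\<close>; finiteness is automatic because the values are complex numbers.\<close>

definition complex_borel_measures :: "(real set \<Rightarrow> complex) set" where
  "complex_borel_measures = {\<mu>. \<forall>A :: nat \<Rightarrow> real set.
     range A \<subseteq> sets borel \<longrightarrow> disjoint_family A \<longrightarrow> (\<lambda>n. \<mu> (A n)) sums \<mu> (\<Union>n. A n)}"

text \<open>The positive variation of a finite signed measure \<open>m\<close>,
  \<open>m\<^sup>+(A) = sup {m B | B \<subseteq> A}\<close>. The coercion \<^const>\<open>ennreal\<close> sends negative values to \<open>0\<close>,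
  which is harmless as \<open>B = {}\<close> is admitted.\<close>

definition positive_variation :: "(real set \<Rightarrow> real) \<Rightarrow> real measure" where
  "positive_variation m =
     measure_of UNIV (sets borel) (\<lambda>A. SUP B\<in>{B \<in> sets borel. B \<subseteq> A}. ennreal (m B))"

text \<open>Integration with respect to a signed measure through its Jordan decomposition
  \<open>m = m\<^sup>+ - (-m)\<^sup>+\<close>, and with respect to a complex measure through real and imaginary part.\<close>

definition signed_integral :: "(real set \<Rightarrow> real) \<Rightarrow> (real \<Rightarrow> complex) \<Rightarrow> complex" where
  "signed_integral m f =
     (LINT x|positive_variation m. f x) - (LINT x|positive_variation (\<lambda>B. - m B). f x)"

definition complex_integral :: "(real set \<Rightarrow> complex) \<Rightarrow> (real \<Rightarrow> complex) \<Rightarrow> complex" where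
  "complex_integral \<mu> f =
     signed_integral (\<lambda>B. Re (\<mu> B)) f + \<i> * signed_integral (\<lambda>B. Im (\<mu> B)) f"

definition fourier_stieltjes :: "(real set \<Rightarrow> complex) \<Rightarrow> real \<Rightarrow> complex" where
  "fourier_stieltjes \<mu> \<xi> = complex_integral \<mu> (\<lambda>x. exp (\<i> * complex_of_real (\<xi> * x)))"

definition B_alg :: "(real \<Rightarrow> complex) set" where
  "B_alg = fourier_stieltjes ` complex_borel_measures"

definition B_loc :: "(real \<Rightarrow> complex) set" where
  "B_loc = {F. \<forall>x. \<exists>U. open U \<and> x \<in> U \<and> (\<exists>G\<in>B_alg. \<forall>\<xi>\<in>U. F \<xi> = G \<xi>)}"


section \<open>Complex unital Banach algebras\<close>

text \<open>Banach algebras are rendered as structures with an explicit carrier (and not by type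
  classes), so that one can quantify over all of them inside a definition.\<close>

definition complex_ring :: "complex ring" where
  "complex_ring = \<lparr>carrier = UNIV, monoid.mult = (*), one = 1, ring.zero = 0, add = (+)\<rparr>"

record 'a normed_alg = "(complex, 'a) module" +
  alg_norm :: "'a \<Rightarrow> real"

text \<open>\<^locale>\<open>Metric_space\<close> asks for symmetry and nonnegativity of the distance
  on the whole type; hence the value \<open>0\<close> outside the carrier.\<close>

definition alg_dist :: "'a normed_alg \<Rightarrow> 'a \<Rightarrow> 'a \<Rightarrow> real" where
  "alg_dist A x y =
     (if x \<in> carrier A \<and> y \<in> carrier A then alg_norm A (x \<ominus>\<^bsub>A\<^esub> y) else 0)"

locale complex_banach_algebra =
  fixes A :: "'a normed_alg" (structure)
  assumes ring: "Ring.ring A"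
    and complex_module: "Module.module complex_ring A"
    and smult_mult_left:
      "\<lbrakk>x \<in> carrier A; y \<in> carrier A\<rbrakk> \<Longrightarrow> (c \<odot> x) \<otimes> y = c \<odot> (x \<otimes> y)"
    and smult_mult_right:
      "\<lbrakk>x \<in> carrier A; y \<in> carrier A\<rbrakk> \<Longrightarrow> x \<otimes> (c \<odot> y) = c \<odot> (x \<otimes> y)"
    and norm_nonneg: "x \<in> carrier A \<Longrightarrow> 0 \<le> alg_norm A x"
    and norm_eq_0: "x \<in> carrier A \<Longrightarrow> alg_norm A x = 0 \<longleftrightarrow> x = \<zero>"
    and norm_triangle:
      "\<lbrakk>x \<in> carrier A; y \<in> carrier A\<rbrakk> \<Longrightarrow> alg_norm A (x \<oplus> y) \<le> alg_norm A x + alg_norm A y"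
    and norm_smult: "x \<in> carrier A \<Longrightarrow> alg_norm A (c \<odot> x) = cmod c * alg_norm A x"
    and norm_mult:
      "\<lbrakk>x \<in> carrier A; y \<in> carrier A\<rbrakk> \<Longrightarrow> alg_norm A (x \<otimes> y) \<le> alg_norm A x * alg_norm A y"
    and norm_one: "alg_norm A \<one> = 1"
    and complete: "Metric_space.mcomplete (carrier A) (alg_dist A)"

definition spectrum :: "'a normed_alg \<Rightarrow> 'a \<Rightarrow> complex set" where
  "spectrum A a = {z. (z \<odot>\<^bsub>A\<^esub> \<one>\<^bsub>A\<^esub>) \<ominus>\<^bsub>A\<^esub> a \<notin> Units A}"

text \<open>The supremum is a maximum, the spectrum being compact and nonempty.\<close>

definition spectral_radius :: "'a normed_alg \<Rightarrow> 'a \<Rightarrow> real" where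
  "spectral_radius A a = (SUP z\<in>spectrum A a. cmod z)"

text \<open>Continuous linear functionals; only their values on the carrier matter.\<close>

definition dual :: "'a normed_alg \<Rightarrow> ('a \<Rightarrow> complex) set" where
  "dual A = {\<phi>.
     (\<forall>x\<in>carrier A. \<forall>y\<in>carrier A. \<phi> (x \<oplus>\<^bsub>A\<^esub> y) = \<phi> x + \<phi> y) \<and>
     (\<forall>c. \<forall>x\<in>carrier A. \<phi> (c \<odot>\<^bsub>A\<^esub> x) = c * \<phi> x) \<and>
     (\<exists>C. \<forall>x\<in>carrier A. cmod (\<phi> x) \<le> C * alg_norm A x)}"

definition dual_norm :: "'a normed_alg \<Rightarrow> ('a \<Rightarrow> complex) \<Rightarrow> real" where
  "dual_norm A \<phi> = (SUP x\<in>{x \<in> carrier A. alg_norm A x \<le> 1}. cmod (\<phi> x))"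

definition numerical_range :: "'a normed_alg \<Rightarrow> 'a \<Rightarrow> complex set" where
  "numerical_range A a = {\<phi> a | \<phi>. \<phi> \<in> dual A \<and> \<phi> \<one>\<^bsub>A\<^esub> = 1 \<and> dual_norm A \<phi> = 1}"

definition hermitian :: "'a normed_alg \<Rightarrow> 'a set" where
  "hermitian A = {a \<in> carrier A. numerical_range A a \<subseteq> \<real>}"


section \<open>Functional calculus\<close>

definition alg_exp :: "'a normed_alg \<Rightarrow> 'a \<Rightarrow> 'a" where
  "alg_exp A x = (THE y. limitin (Metric_space.mtopology (carrier A) (alg_dist A))
     (\<lambda>n. \<Oplus>\<^bsub>A\<^esub>k\<in>{..<n}. complex_of_real (1 / fact k) \<odot>\<^bsub>A\<^esub> (x [^]\<^bsub>A\<^esub> k)) y sequentially)"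

text \<open>The integral of a bounded continuous algebra-valued function against a complex measure, as
  the unique element whose image under every continuous functional is the scalar integral (for
  bounded norm-continuous integrands this is also the Bochner integral).\<close>

definition alg_integral ::
    "'a normed_alg \<Rightarrow> (real set \<Rightarrow> complex) \<Rightarrow> (real \<Rightarrow> 'a) \<Rightarrow> 'a" where
  "alg_integral A \<mu> f =
     (THE b. b \<in> carrier A \<and> (\<forall>\<phi>\<in>dual A. \<phi> b = complex_integral \<mu> (\<lambda>t. \<phi> (f t))))"

text \<open>For Hermitian \<open>a\<close> the spectrum is real, and \<open>U\<close> is a real neighbourhood of it.\<close>

definition represents_near_spectrum ::
    "'a normed_alg \<Rightarrow> 'a \<Rightarrow> (real \<Rightarrow> complex) \<Rightarrow> (real set \<Rightarrow> complex) \<Rightarrow> bool" where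
  "represents_near_spectrum A a F \<mu> \<longleftrightarrow> \<mu> \<in> complex_borel_measures \<and>
     (\<exists>U. open U \<and> spectrum A a \<subseteq> complex_of_real ` U \<and> (\<forall>\<xi>\<in>U. F \<xi> = fourier_stieltjes \<mu> \<xi>))"

definition symbol_apply :: "'a normed_alg \<Rightarrow> (real \<Rightarrow> complex) \<Rightarrow> 'a \<Rightarrow> 'a" where
  "symbol_apply A F a = alg_integral A (SOME \<mu>. represents_near_spectrum A a F \<mu>)
     (\<lambda>t. alg_exp A ((\<i> * complex_of_real t) \<odot>\<^bsub>A\<^esub> a))"


section \<open>Universal symbols\<close>

definition universal_over :: "'a itself \<Rightarrow> (real \<Rightarrow> complex) \<Rightarrow> bool" where
  "universal_over _ F \<longleftrightarrow> (\<forall>A :: 'a normed_alg. complex_banach_algebra A \<longrightarrow>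
     (\<forall>a\<in>hermitian A. alg_norm A (symbol_apply A F a) = spectral_radius A (symbol_apply A F a)))"

text \<open>A definition in HOL cannot quantify over types, so the elements of the algebras are taken
  from one fixed type. This is no restriction. The norm and spectral radius of
  \<open>F(a)\<close> can be computed in the closed subalgebra generated by the unit and \<open>a\<close>: numerical ranges
  do not change (Hahn--Banach), nor do the spectra of \<open>a\<close> (which is real) and, by the spectral
  radius formula, the spectral radius of \<open>F(a)\<close>. That subalgebra is separable, so it has at most
  the cardinality of the continuum and is isomorphic to one whose carrier is a subset of
  \<^typ>\<open>real \<Rightarrow> complex\<close>.\<close>

definition US :: "(real \<Rightarrow> complex) set" where
  "US = {F \<in> B_loc. universal_over TYPE(real \<Rightarrow> complex) F}"

definition min_modulus_set :: "(real \<Rightarrow> complex) \<Rightarrow> real set" where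
  "min_modulus_set F = {x. cmod (F x) = (INF t. cmod (F t))}"

end

theory Submission
  imports Defs "HOL-Probability.Sinc_Integral"
begin

text \<open>
Write \<open>f = |F|\<close>. The theorem follows from a single inequality about the values of \<open>f\<close> at three
equidistant points: for all \<open>h > 0\<close> and \<open>s \<ge> 0\<close>,

\<open>f(y) + s |f(y-h) - f(y+h)| \<le> max {f(y-h), f(y), f(y+h)} \<cdot> \<surd>(1 + 4s\<^sup>2)\<close>.

The inequality comes from applying universality in one three-dimensional algebra: the functions on
\<open>{-1, 0, 1}\<close> with pointwise product, normed by duality with the trigonometric polynomials
\<open>p(t) = \<Sum> c\<^sub>k e\<^sup>i\<^sup>k\<^sup>t\<close> of sup norm at most \<open>1\<close>, where \<open>p\<close> is paired with \<open>g\<close> by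
\<open>\<Sum> c\<^sub>k g(k)\<close>. The element \<open>a\<close> with values \<open>y-h, y, y+h\<close> is Hermitian, since pairing \<open>exp(ita)\<close> with \<open>p\<close>
gives a value of \<open>p\<close> up to a phase, so that \<open>exp(ita)\<close> has norm \<open>1\<close>. The element \<open>F(a)\<close> has the values
\<open>F(y-h), F(y), F(y+h)\<close>, and its spectral radius is the largest of their moduli. Now pair \<open>F(a)\<close> with
\<open>1 + s(u e\<^sup>-\<^sup>i\<^sup>t - u' e\<^sup>i\<^sup>t)\<close>, where \<open>|u| = 1\<close> and \<open>u'\<close> is the conjugate of \<open>u\<close>. The bracket is purely imaginary, so the
sup norm of the polynomial is at most \<open>\<surd>(1 + 4s\<^sup>2)\<close>, which is \<open>1\<close> up to second order in \<open>s\<close>. But for a suitable \<open>u\<close>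
the pairing has modulus at least \<open>f(y) + s |f(y-h) - f(y+h)|\<close> (\<open>node_norm_three_point\<close>,
\<open>universal_symbol_three_point\<close>).

Comparing the terms of first order in \<open>s\<close>: if \<open>f(y)\<close> is the largest of the three values, then
\<open>f(y-h) = f(y+h)\<close>. Thus \<open>f\<close> is symmetric around every interior maximum, and the symmetry around points
nearby then rules out interior maxima larger than the boundary values
(\<open>quasiconvex_of_three_point\<close>). Hence the set where \<open>f\<close> is minimal is an interval, and a similar
argument shows that \<open>f\<close> is injective on the components of the complement, hence strictly monotone there.
If \<open>f\<close> were increasing and bounded on a half-line with supremum \<open>L\<close>, fix \<open>x = y - h\<close> and let \<open>y\<close> tend to infinity:
the inequality becomes \<open>L + s(L - f(x)) \<le> L \<surd>(1 + 4s\<^sup>2)\<close>, and small \<open>s\<close> yields \<open>L \<le> f(x)\<close>.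

What remains is to identify \<open>F(a)\<close>. This takes one measure representing \<open>F\<close> near all three points,
whereas membership in \<^const>\<open>B_loc\<close> gives a measure near each of them. The measures are glued with
trapezoidal functions in the Fourier algebra. These are second differences of \<open>|\<xi>|\<close>, and \<open>|\<xi>|\<close> is
a multiple of \<open>\<integral> (1 - cos(\<xi>x))/x\<^sup>2 dx\<close> by scaling, which exhibits their densities
(\<open>abs_as_cos_integral\<close>, \<open>B_loc_near_finite_set\<close>). Convolutions of complex measures are built as
functionals on bounded Borel functions; countable additivity and linearity of the integral against a
complex measure rest on its Jordan decomposition.
\<close>


section \<open>Continuous functions with the three-point inequality\<close>

text \<open>The square root grows only quadratically in \<open>s\<close>, the left-hand side linearly. For nonnegative \<open>f\<close>
this makes a large middle value incompatible with different outer values.\<close>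

definition three_point_inequality :: "(real \<Rightarrow> real) \<Rightarrow> bool" where
  "three_point_inequality f \<longleftrightarrow> (\<forall>y h s. 0 < h \<longrightarrow> 0 \<le> s \<longrightarrow>
     f y + s * \<bar>f (y - h) - f (y + h)\<bar> \<le> max (f y) (max (f (y - h)) (f (y + h))) * sqrt (1 + 4 * s\<^sup>2))"

lemma sqrt_one_plus_le: "sqrt (1 + 4 * s\<^sup>2) \<le> 1 + 2 * s\<^sup>2" for s :: real
proof (rule real_le_lsqrt)
  show "1 + 4 * s\<^sup>2 \<le> (1 + 2 * s\<^sup>2)\<^sup>2"
    by (simp add: power2_sum power_mult_distrib)
qed auto

lemma three_point_inequalityD:
  assumes "three_point_inequality f" "0 < h" "0 \<le> s" "0 \<le> M"
    and "f y \<le> M" "f (y - h) \<le> M" "f (y + h) \<le> M"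
  shows "f y + s * \<bar>f (y - h) - f (y + h)\<bar> \<le> M * (1 + 2 * s\<^sup>2)"
proof -
  have "f y + s * \<bar>f (y - h) - f (y + h)\<bar>
      \<le> max (f y) (max (f (y - h)) (f (y + h))) * sqrt (1 + 4 * s\<^sup>2)"
    using assms(1-3) unfolding three_point_inequality_def by blast
  also have "\<dots> \<le> M * sqrt (1 + 4 * s\<^sup>2)"
    using assms(5-7) by (intro mult_right_mono) auto
  also have "\<dots> \<le> M * (1 + 2 * s\<^sup>2)"
    using sqrt_one_plus_le assms(4) by (intro mult_left_mono)
  finally show ?thesis .
qed

text \<open>Comparison of the terms of first order as \<open>s\<close> tends to \<open>0\<close>.\<close>

lemma le_zero_if_le_small_multiple:
  fixes d K :: real
  assumes "\<And>s. 0 < s \<Longrightarrow> s * d \<le> K * s\<^sup>2" "0 \<le> K"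
  shows "d \<le> 0"
proof (rule ccontr)
  assume "\<not> d \<le> 0"
  hence d: "0 < d" by simp
  have "d \<le> K * s" if "0 < s" for s
    using assms(1)[OF that] that by (simp add: power2_eq_square field_simps)
  note bound = this
  have "d \<le> K * (d / (2 * (K + 1)))"
    using d assms(2) by (intro bound) simp
  also have "\<dots> = d * (K / (2 * (K + 1)))" by simp
  also have "\<dots> < d * 1"
    using d assms(2) by (intro mult_strict_left_mono) (auto simp: field_simps)
  finally show False by simp
qed

text \<open>With \<open>f y\<close> as the maximum, the terms of order zero in the inequality cancel, and those of first order
force the outer values to agree.\<close>

lemma three_point_symmetry:
  assumes "three_point_inequality f" "\<And>x. 0 \<le> f x" "0 < h"
    and "f (y - h) \<le> f y" "f (y + h) \<le> f y"
  shows "f (y - h) = f (y + h)"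
proof -
  have "s * \<bar>f (y - h) - f (y + h)\<bar> \<le> (2 * f y) * s\<^sup>2" if "0 < s" for s
    using three_point_inequalityD[OF assms(1,3), of s "f y" y] that assms(2,4,5)
    by (simp add: algebra_simps)
  hence "\<bar>f (y - h) - f (y + h)\<bar> \<le> 0"
    by (rule le_zero_if_le_small_multiple) (use assms(2) in auto)
  thus ?thesis by simp
qed

lemma three_point_inequality_reflect:
  assumes "three_point_inequality f"
  shows "three_point_inequality (\<lambda>x. f (- x))"
  unfolding three_point_inequality_def
proof (intro allI impI)
  fix y h s :: real assume "0 < h" "0 \<le> s"
  with assms have "f (- y) + s * \<bar>f (- y - h) - f (- y + h)\<bar>
      \<le> max (f (- y)) (max (f (- y - h)) (f (- y + h))) * sqrt (1 + 4 * s\<^sup>2)"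
    unfolding three_point_inequality_def by blast
  thus "f (- y) + s * \<bar>f (- (y - h)) - f (- (y + h))\<bar>
      \<le> max (f (- y)) (max (f (- (y - h))) (f (- (y + h)))) * sqrt (1 + 4 * s\<^sup>2)"
    by (simp add: max.commute abs_minus_commute)
qed

text \<open>Suppose that the maximum over \<open>[x, z]\<close> exceeds the values at the ends, and let it be attained at \<open>p\<close>.
Then \<open>f\<close> is symmetric around \<open>p\<close>; put \<open>g u = f (p + u) = f (p - u)\<close>. The points \<open>p - u\<close>, \<open>p + u\<close>,
\<open>p + 3u\<close> are equidistant with values \<open>g u\<close>, \<open>g u\<close>, \<open>g (3u)\<close>, so \<open>g (3u) < g u\<close> would contradict
\<open>three_point_symmetry\<close>. Hence \<open>g u \<le> g (3u)\<close>, and by iteration and continuity \<open>f p = g 0\<close> is at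
most the value of \<open>g\<close> at the end of the largest symmetric interval, which is an end of
\<open>[x, z]\<close>: a contradiction.\<close>

lemma quasiconvex_of_three_point:
  assumes tp: "three_point_inequality f" and nn: "\<And>x. 0 \<le> f x"
    and cont: "continuous_on UNIV f" and "x < y" "y < z"
  shows "f y \<le> max (f x) (f z)"
proof (rule ccontr)
  assume neg: "\<not> f y \<le> max (f x) (f z)"
  have "\<exists>p\<in>{x..z}. \<forall>t\<in>{x..z}. f t \<le> f p"
    using assms by (intro continuous_attains_sup continuous_on_subset[OF cont]) auto
  then obtain p where p: "p \<in> {x..z}" "\<And>t. t \<in> {x..z} \<Longrightarrow> f t \<le> f p" by auto
  have "f y \<le> f p" using p(2)[of y] assms by auto
  hence big: "f x < f p" "f z < f p" using neg by auto
  define d where "d = min (p - x) (z - p)"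
  have "x < p" "p < z" using p(1) big by (auto simp: less_le)
  hence d: "0 < d" and box: "p - d \<ge> x" "p + d \<le> z" by (auto simp: d_def)
  define g where "g u = f (p + u)" for u
  have sym: "f (p - u) = g u" if "0 < u" "u \<le> d" for u
    using three_point_symmetry[OF tp nn that(1), of p] p(2) that box unfolding g_def by auto
  have ends: "g d < f p"
  proof (cases "p - x \<le> z - p")
    case True
    hence "d = p - x" by (simp add: d_def)
    hence "f (p - d) = f x" by simp
    thus ?thesis using sym[OF d order_refl] big by simp
  next
    case False
    hence "d = z - p" by (simp add: d_def)
    thus ?thesis using big by (simp add: g_def)
  qed
  \<comment> \<open>The points \<open>p - u\<close>, \<open>p + u\<close>, \<open>p + 3u\<close> have mutual distance \<open>2u\<close> and middle \<open>p + u\<close>.\<close>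
  have tripling: "g u \<le> g (3 * u)" if "0 < u" "3 * u \<le> d" for u
  proof (rule ccontr)
    assume less: "\<not> g u \<le> g (3 * u)"
    have "f (p + u - 2 * u) = g u" using sym[of u] that by (simp add: algebra_simps)
    moreover have "f (p + u + 2 * u) = g (3 * u)" by (simp add: g_def algebra_simps)
    ultimately have "g u = g (3 * u)"
      using three_point_symmetry[OF tp nn, of "2 * u" "p + u"] that less by (simp add: g_def)
    thus False using less by simp
  qed
  have le: "g (d / 3 ^ n) \<le> g d" for n
  proof (induction n)
    case (Suc n)
    have "g (d / 3 ^ Suc n) \<le> g (3 * (d / 3 ^ Suc n))"
      using d by (intro tripling) (auto simp: field_simps mult_le_cancel_left1)
    thus ?case using Suc by simp
  qed auto
  have "(\<lambda>n. p + d * (1 / 3) ^ n) \<longlonglongrightarrow> p + d * 0"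
    by (intro tendsto_intros LIMSEQ_power_zero) auto
  hence "(\<lambda>n. f (p + d * (1 / 3) ^ n)) \<longlonglongrightarrow> f p"
    using cont by (intro isCont_tendsto_compose[where g = f]) (auto simp: continuous_on_eq_continuous_at)
  hence "(\<lambda>n. g (d / 3 ^ n)) \<longlonglongrightarrow> f p"
    by (simp add: g_def power_one_over)
  hence "f p \<le> g d" using le by (intro LIMSEQ_le_const2) auto
  thus False using ends by simp
qed

text \<open>Let \<open>c\<close> be the leftmost point of \<open>[p, b]\<close> where the value \<open>v\<close> is attained. By quasiconvexity \<open>f\<close> equals \<open>v\<close> on
\<open>[c, b]\<close> and is at most \<open>v\<close> to the left, so symmetry around \<open>c\<close> carries the value \<open>v\<close> over to the left of \<open>c\<close>.\<close>

lemma not_constant_right_of_smaller_value: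
  assumes tp: "three_point_inequality f" and nn: "\<And>x. 0 \<le> f x"
    and cont: "continuous_on UNIV f" and "p < a" "a < b" "f p < v"
    and const: "\<And>t. t \<in> {a..b} \<Longrightarrow> f t = v"
  shows False
proof -
  define S where "S = {t\<in>{p..b}. f t = v}"
  have "S = {p..b} \<inter> f -` {v}" by (auto simp: S_def)
  moreover have "closed ({p..b} \<inter> f -` {v})"
    using continuous_on_subset[OF cont] by (intro continuous_closed_preimage) auto
  ultimately have "compact S"
    by (metis compact_Icc compact_Int_closed closed_Int_compact inf.absorb_iff2 inf_le1 inf_commute)
  moreover have "a \<in> S" using const[of a] assms(4,5) by (auto simp: S_def)
  ultimately obtain c where c: "c \<in> S" "\<And>t. t \<in> S \<Longrightarrow> c \<le> t"
    using compact_attains_inf[of S] by auto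
  have "c \<le> a" using c(2) \<open>a \<in> S\<close> .
  have "p < c" "f c = v" using c(1) \<open>f p < v\<close> by (auto simp: S_def less_le)
  have fb: "f b = v" using const[of b] \<open>a < b\<close> by auto
  have le: "f t \<le> v" if "p \<le> t" "t \<le> b" for t
    using quasiconvex_of_three_point[OF tp nn cont, of p t b] that \<open>f p < v\<close> fb
    by (cases "t = p"; cases "t = b") auto
  have ge: "v \<le> f t" if "c < t" "t \<le> b" for t
    using quasiconvex_of_three_point[OF tp nn cont \<open>p < c\<close> that(1)] \<open>f p < v\<close> \<open>f c = v\<close> by auto
  define h where "h = min (c - p) (b - c)"
  have h: "0 < h" "c - h \<ge> p" "c + h \<le> b"
    using \<open>p < c\<close> \<open>c \<le> a\<close> \<open>a < b\<close> by (auto simp: h_def)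
  have "f (c + h) = v" using ge[of "c + h"] le[of "c + h"] h by auto
  moreover have "f (c - h) \<le> v" using le[of "c - h"] h by auto
  ultimately have "f (c - h) = v"
    using three_point_symmetry[OF tp nn h(1), of c] \<open>f c = v\<close> by simp
  hence "c - h \<in> S" using h by (auto simp: S_def)
  thus False using c(2)[of "c - h"] h by simp
qed

text \<open>The minimum of \<open>f\<close> over \<open>[a, b]\<close>, attained at \<open>c\<close>, is not the infimum of \<open>f\<close>, so a smaller value is
taken at some \<open>p\<close> outside \<open>[a, b]\<close>. The endpoint between \<open>p\<close> and \<open>c\<close> then has a value at most \<open>f c\<close>, so
\<open>f\<close> is constant on \<open>[a, b]\<close>, which the preceding lemma excludes.\<close>

lemma three_point_inj_above_inf:
  assumes tp: "three_point_inequality f" and nn: "\<And>x. 0 \<le> f x"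
    and cont: "continuous_on UNIV f" and "a < b" "f a = f b"
    and above: "\<And>t. t \<in> {a..b} \<Longrightarrow> (INF t. f t) < f t"
  shows False
proof -
  have "\<exists>c\<in>{a..b}. \<forall>t\<in>{a..b}. f c \<le> f t"
    using assms by (intro continuous_attains_inf continuous_on_subset[OF cont]) auto
  then obtain c where c: "c \<in> {a..b}" "\<And>t. t \<in> {a..b} \<Longrightarrow> f c \<le> f t" by auto
  obtain p where p: "f p < f c"
    using above[OF c(1)] by (subst (asm) cINF_less_iff) (use nn in \<open>auto intro!: bdd_belowI2[of _ 0]\<close>)
  have qc: "f t \<le> max (f u) (f v)" if "u \<le> t" "t \<le> v" for u t v
    using quasiconvex_of_three_point[OF tp nn cont, of u t v] that by (cases "t = u"; cases "t = v") auto
  have "p < a \<or> b < p" using c(2)[of p] p by (cases "p < a"; cases "b < p") auto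
  hence "f a \<le> f c"
    using qc[of p a c] qc[of c b p] p c(1) \<open>f a = f b\<close> by auto
  hence const: "f t = f c" if "t \<in> {a..b}" for t
    using qc[of a t b] c(2)[OF that] that \<open>f a = f b\<close> by auto
  show False using \<open>p < a \<or> b < p\<close>
  proof
    assume "p < a"
    thus False using not_constant_right_of_smaller_value[OF tp nn cont _ \<open>a < b\<close> p const] by blast
  next
    assume "b < p"
    have "continuous_on UNIV (\<lambda>x. f (- x))"
      by (intro continuous_on_compose2[OF cont] continuous_intros) auto
    thus False
    proof (rule not_constant_right_of_smaller_value[OF three_point_inequality_reflect[OF tp] nn])
      show "- p < - b" "- b < - a" "f (- (- p)) < f c" using \<open>b < p\<close> \<open>a < b\<close> p by auto
      show "f (- t) = f c" if "t \<in> {- b..- a}" for t using const[of "- t"] that by auto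
    qed
  qed
qed

text \<open>Here the inequality is used for distant points: \<open>u\<close> stays fixed as the left point, and the two others
move to the right until their values are close to the supremum \<open>L\<close>.\<close>

lemma three_point_increasing_unbounded:
  assumes tp: "three_point_inequality f" and nn: "\<And>x. 0 \<le> f x"
    and mono: "strict_mono_on {u..} f"
  shows "\<not> bdd_above (f ` {u..})"
proof
  assume bdd: "bdd_above (f ` {u..})"
  define L where "L = (SUP t\<in>{u..}. f t)"
  have up: "f t \<le> L" if "u \<le> t" for t
    unfolding L_def using that bdd by (intro cSUP_upper) auto
  have "f u < f (u + 1)" using mono by (auto simp: strict_mono_on_def)
  hence uL: "f u < L" using up[of "u + 1"] by simp
  have "s * (L - f u) \<le> (2 * L) * s\<^sup>2" if s: "0 < s" for s
  proof (rule field_le_epsilon)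
    fix e :: real assume e: "0 < e"
    \<comment> \<open>The error \<open>e'\<close> enters once through \<open>f y\<close> and \<open>s\<close> times through the value at \<open>z\<close>.\<close>
    define e' where "e' = e / (1 + s)"
    have e': "0 < e'" "e' * (1 + s) = e" using e s by (auto simp: e'_def)
    obtain y0 where y0: "u \<le> y0" "L - e' < f y0"
      using less_cSUP_iff[OF _ bdd, of "L - e'"] e' unfolding L_def by auto
    define y where "y = y0 + 1"
    have inc: "f t \<le> f t'" if "u \<le> t" "t \<le> t'" for t t'
      using mono that by (cases "t = t'") (auto simp: strict_mono_on_def less_imp_le)
    define z where "z = 2 * y - u"
    have "f y \<ge> L - e'" "f z \<ge> L - e'"
      using inc[of y0 y] inc[of y0 z] y0 by (auto simp: y_def z_def)
    moreover have "f y + s * \<bar>f (y - (y - u)) - f (y + (y - u))\<bar> \<le> L * (1 + 2 * s\<^sup>2)"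
      using y0 s uL nn[of u] up
      by (intro three_point_inequalityD[OF tp]) (auto simp: y_def)
    moreover have "y + (y - u) = z" by (simp add: z_def)
    moreover have "f u \<le> f z" using inc y0 by (auto simp: z_def y_def)
    ultimately have "L - e' + s * (f z - f u) \<le> L * (1 + 2 * s\<^sup>2)" by simp
    moreover have "s * (L - e' - f u) \<le> s * (f z - f u)"
      using \<open>f z \<ge> L - e'\<close> s by (intro mult_left_mono) auto
    ultimately have "s * (L - f u) \<le> (2 * L) * s\<^sup>2 + e' * (1 + s)"
      by (simp add: algebra_simps)
    thus "s * (L - f u) \<le> (2 * L) * s\<^sup>2 + e" using e'(2) by simp
  qed
  hence "L - f u \<le> 0"
    by (rule le_zero_if_le_small_multiple) (use uL nn[of u] in auto)
  thus False using uL by simp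
qed

text \<open>If the component did not reach infinity on the right, a minimum point would lie to the right of it,
and quasiconvexity would prevent \<open>f\<close> from increasing. The component enters only through openness
and maximality, two properties that pass to the reflected set.\<close>

lemma three_point_increasing_component_unbounded:
  assumes tp: "three_point_inequality f" and nn: "\<And>x. 0 \<le> f x"
    and cont: "continuous_on UNIV f"
    and "open U" "U \<noteq> {}" and above: "\<And>x. x \<in> U \<Longrightarrow> f x \<noteq> (INF t. f t)"
    and maximal: "\<And>C. connected C \<Longrightarrow> C \<inter> U \<noteq> {} \<Longrightarrow> C \<subseteq> {x. f x \<noteq> (INF t. f t)} \<Longrightarrow> C \<subseteq> U"
    and mono: "strict_mono_on U f"
  shows "\<not> bounded (f ` U)"
proof -
  let ?m = "INF t. f t"
  have low: "?m \<le> f t" for t by (intro cINF_lower) (use nn in \<open>auto intro!: bdd_belowI2[of _ 0]\<close>)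
  obtain u where u: "u \<in> U" using \<open>U \<noteq> {}\<close> by auto
  have "{u..} \<subseteq> {x. f x \<noteq> ?m}"
  proof (rule ccontr)
    assume "\<not> {u..} \<subseteq> {x. f x \<noteq> ?m}"
    then obtain p where p: "u \<le> p" "f p = ?m" by auto
    obtain e where e: "0 < e" "ball u e \<subseteq> U" using \<open>open U\<close> u by (auto simp: open_contains_ball)
    have "p \<notin> U" using above p by auto
    hence "p \<ge> u + e" using e p by (auto simp: subset_eq dist_real_def)
    define w where "w = u + e / 2"
    have w: "w \<in> U" "u < w" "w < p"
      using e \<open>p \<ge> u + e\<close> by (auto simp: w_def subset_eq dist_real_def)
    have "f u < f w" using mono u w by (auto simp: strict_mono_on_def)
    thus False
      using quasiconvex_of_three_point[OF tp nn cont w(2,3)] p(2) low[of u] by auto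
  qed
  hence "{u..} \<subseteq> U"
    using maximal[of "{u..}"] u by auto
  hence "strict_mono_on {u..} f" using mono by (auto simp: strict_mono_on_def)
  from three_point_increasing_unbounded[OF tp nn this] \<open>{u..} \<subseteq> U\<close> show ?thesis
    by (meson bdd_above_mono bounded_imp_bdd_above image_mono)
qed

lemma three_point_structure:
  assumes tp: "three_point_inequality f" and nn: "\<And>x. 0 \<le> f x"
    and cont: "continuous_on UNIV f"
  shows "connected {x. f x = (INF t. f t)}"
    and "U \<in> components {x. f x \<noteq> (INF t. f t)} \<Longrightarrow>
      (strict_mono_on U f \<or> strict_antimono_on U f) \<and> \<not> bounded (f ` U)"
proof -
  let ?m = "INF t. f t"
  have low: "?m \<le> f t" for t by (intro cINF_lower) (use nn in \<open>auto intro!: bdd_belowI2[of _ 0]\<close>)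
  show "connected {x. f x = ?m}"
    unfolding connected_iff_interval
  proof (clarsimp)
    fix x z y assume "f x = ?m" "f z = ?m" "x \<le> y" "y \<le> z"
    thus "f y = ?m"
      using quasiconvex_of_three_point[OF tp nn cont, of x y z] low[of y]
      by (cases "y = x"; cases "y = z") auto
  qed
  show "(strict_mono_on U f \<or> strict_antimono_on U f) \<and> \<not> bounded (f ` U)"
    if U: "U \<in> components {x. f x \<noteq> ?m}"
  proof -
    have iv: "is_interval U" using in_components_connected[OF U] is_interval_connected_1 by blast
    have "inj_on f U"
    proof (rule linorder_inj_onI)
      fix a b assume "a < b" "a \<in> U" "b \<in> U"
      have "{a..b} \<subseteq> U"
        using mem_is_interval_1_I[OF iv \<open>a \<in> U\<close> \<open>b \<in> U\<close>] by (meson atLeastAtMost_iff subsetI)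
      hence "?m < f t" if "t \<in> {a..b}" for t
        using in_components_subset[OF U] that low[of t] by (force simp: less_le)
      thus "f a \<noteq> f b" using three_point_inj_above_inf[OF tp nn cont \<open>a < b\<close>] by blast
    qed (rule linear)
    hence mono: "strict_mono_on U f \<or> strict_antimono_on U f"
      using injective_eq_monotone_map[OF iv continuous_on_subset[OF cont subset_UNIV]] by blast
    moreover have "\<not> bounded (f ` U)"
    proof -
      have "open {x. f x \<noteq> ?m}"
        using cont by (intro open_Collect_neq) auto
      hence "open U" using U open_components by blast
      have "U \<noteq> {}" using in_components_nonempty[OF U] .
      have above: "f x \<noteq> ?m" if "x \<in> U" for x using in_components_subset[OF U] that by auto
      have maximal: "C \<subseteq> U" if "connected C" "C \<inter> U \<noteq> {}" "C \<subseteq> {x. f x \<noteq> ?m}" for C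
        using components_maximal[OF U] that by blast
      show ?thesis
        using mono
      proof
        assume "strict_mono_on U f"
        thus ?thesis
          by (intro three_point_increasing_component_unbounded[OF tp nn cont \<open>open U\<close> \<open>U \<noteq> {}\<close> above maximal])
      next
        assume anti: "strict_antimono_on U f"
        let ?g = "\<lambda>x. f (- x)"
        have "range ?g = range f" by (metis surj_uminus image_image)
        hence inf: "(INF t. ?g t) = ?m" by simp
        have "\<not> bounded (?g ` uminus ` U)"
        proof (rule three_point_increasing_component_unbounded[OF three_point_inequality_reflect[OF tp] nn])
          show "continuous_on UNIV ?g"
            by (intro continuous_on_compose2[OF cont] continuous_intros) auto
          show "open (uminus ` U)" using \<open>open U\<close> by (rule open_negations)
          show "uminus ` U \<noteq> {}" using \<open>U \<noteq> {}\<close> by simp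
          show "?g x \<noteq> (INF t. ?g t)" if "x \<in> uminus ` U" for x
            unfolding inf using above that by auto
          show "strict_mono_on (uminus ` U) ?g"
            using anti by (auto simp: monotone_on_def)
          show "C \<subseteq> uminus ` U"
            if C: "connected C" "C \<inter> uminus ` U \<noteq> {}" "C \<subseteq> {x. ?g x \<noteq> (INF t. ?g t)}" for C
          proof -
            have "uminus ` C \<subseteq> U"
            proof (rule maximal)
              show "connected (uminus ` C)"
                using C(1) by (intro connected_continuous_image continuous_intros)
              show "uminus ` C \<inter> U \<noteq> {}" using C(2) by force
              show "uminus ` C \<subseteq> {x. f x \<noteq> ?m}" using C(3) inf by auto
            qed
            thus ?thesis by (force simp: image_iff)
          qed
        qed
        thus ?thesis by (simp add: image_image)
      qed
    qed
    ultimately show ?thesis by blast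
  qed
qed


section \<open>Jordan decomposition of a signed measure\<close>

text \<open>The real and imaginary parts of a complex measure satisfy this. Finiteness of the variation is part
of what has to be proved (\<open>upper_finite\<close>).\<close>

locale signed_borel_measure =
  fixes m :: "real set \<Rightarrow> real"
  assumes sums_UN: "\<And>A :: nat \<Rightarrow> real set. range A \<subseteq> sets borel \<Longrightarrow> disjoint_family A
    \<Longrightarrow> (\<lambda>n. m (A n)) sums m (\<Union>n. A n)"
begin

lemma empty [simp]: "m {} = 0"
proof -
  have "(\<lambda>n::nat. m {}) sums m (\<Union>n::nat. {})"
    by (rule sums_UN) (auto simp: disjoint_family_on_def)
  hence "summable (\<lambda>n::nat. m {})" by (rule sums_summable)
  thus ?thesis by (simp add: summable_const_iff)
qed

lemma union:
  assumes "A \<in> sets borel" "B \<in> sets borel" "A \<inter> B = {}"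
  shows "m (A \<union> B) = m A + m B"
proof -
  have "(\<lambda>n. m (binaryset A B n)) sums m (\<Union>n. binaryset A B n)"
    using assms by (intro sums_UN) (auto simp: range_binaryset_eq disjoint_family_on_def binaryset_def)
  moreover have "(\<lambda>n. m (binaryset A B n)) sums (m A + m B)"
    by (rule binaryset_sums) simp
  ultimately show ?thesis
    by (simp add: UN_binaryset_eq sums_unique2)
qed

lemma diff:
  assumes "A \<in> sets borel" "B \<in> sets borel" "B \<subseteq> A"
  shows "m (A - B) = m A - m B"
proof -
  have "m (B \<union> (A - B)) = m B + m (A - B)" using assms by (intro union) auto
  moreover have "B \<union> (A - B) = A" using assms by auto
  ultimately show ?thesis by simp
qed

text \<open>The set function from which \<^const>\<open>positive_variation\<close> is made.\<close>

definition upper :: "real set \<Rightarrow> ennreal" where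
  "upper A = (SUP B\<in>{B \<in> sets borel. B \<subseteq> A}. ennreal (m B))"

lemma le_upper: "B \<in> sets borel \<Longrightarrow> B \<subseteq> A \<Longrightarrow> ennreal (m B) \<le> upper A"
  unfolding upper_def by (rule SUP_upper) auto

lemma upper_le: "(\<And>B. B \<in> sets borel \<Longrightarrow> B \<subseteq> A \<Longrightarrow> ennreal (m B) \<le> c) \<Longrightarrow> upper A \<le> c"
  unfolding upper_def by (rule SUP_least) auto

lemma upper_mono: "A \<subseteq> B \<Longrightarrow> upper A \<le> upper B"
  by (rule upper_le) (auto intro: le_upper)

text \<open>A set of negative measure contributes nothing, so in the supremum one may pass to the union of two sets of
nonnegative measure, or simply drop one of the two.\<close>

lemma upper_superadditive:
  assumes "A \<in> sets borel" "B \<in> sets borel" "A \<inter> B = {}"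
  shows "upper A + upper B \<le> upper (A \<union> B)"
proof -
  have pair: "ennreal (m C) + ennreal (m D) \<le> upper (A \<union> B)"
    if "C \<in> sets borel" "C \<subseteq> A" "D \<in> sets borel" "D \<subseteq> B" for C D
  proof (cases "0 \<le> m C \<and> 0 \<le> m D")
    case True
    have "ennreal (m C) + ennreal (m D) = ennreal (m (C \<union> D))"
      using True that assms(3) by (subst union) (auto simp: ennreal_plus)
    thus ?thesis using le_upper[of "C \<union> D" "A \<union> B"] that by auto
  next
    case False
    hence "ennreal (m C) + ennreal (m D) = ennreal (m C) \<or> ennreal (m C) + ennreal (m D) = ennreal (m D)"
      by (auto simp: ennreal_neg)
    thus ?thesis using le_upper[of C "A \<union> B"] le_upper[of D "A \<union> B"] that by (metis le_supI1 le_supI2)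
  qed
  let ?S = "\<lambda>A. {B \<in> sets borel. B \<subseteq> A}"
  have ne: "?S X \<noteq> {}" for X :: "real set" by auto
  have "upper A + upper B = (SUP C\<in>?S A. ennreal (m C) + upper B)"
    by (subst ennreal_SUP_add_left[OF ne]) (simp add: upper_def)
  also have "\<dots> \<le> upper (A \<union> B)"
  proof (rule SUP_least)
    fix C assume C: "C \<in> ?S A"
    have "ennreal (m C) + upper B = (SUP D\<in>?S B. ennreal (m C) + ennreal (m D))"
      by (subst ennreal_SUP_add_right[OF ne, symmetric]) (simp add: upper_def)
    also have "\<dots> \<le> upper (A \<union> B)"
      using C pair by (intro SUP_least) auto
    finally show "ennreal (m C) + upper B \<le> upper (A \<union> B)" .
  qed
  finally show ?thesis .
qed

lemma upper_empty [simp]: "upper {} = 0"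
  by (rule antisym[OF upper_le]) auto

lemma upper_UN:
  fixes A :: "nat \<Rightarrow> real set"
  assumes "range A \<subseteq> sets borel" "disjoint_family A"
  shows "(\<Sum>n. upper (A n)) = upper (\<Union>n. A n)"
proof (rule antisym)
  have meas: "A n \<in> sets borel" for n using assms by auto
  have "(\<Sum>n<N. upper (A n)) \<le> upper (\<Union>n<N. A n)" for N
  proof (induction N)
    case (Suc N)
    have "(\<Sum>n<Suc N. upper (A n)) \<le> upper (\<Union>n<N. A n) + upper (A N)"
      using Suc by (simp add: add_mono)
    also have "\<dots> \<le> upper ((\<Union>n<N. A n) \<union> A N)"
    proof (rule upper_superadditive)
      have "A n \<inter> A N = {}" if "n < N" for n
        using that by (intro disjoint_family_onD[OF assms(2)]) auto
      thus "(\<Union>n<N. A n) \<inter> A N = {}" by auto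
    qed (use meas in auto)
    also have "(\<Union>n<N. A n) \<union> A N = (\<Union>n<Suc N. A n)" by (auto simp: less_Suc_eq)
    finally show ?case .
  qed simp
  also have "upper (\<Union>n<N. A n) \<le> upper (\<Union>n. A n)" for N by (rule upper_mono) auto
  finally have *: "(\<Sum>n<N. upper (A n)) \<le> upper (\<Union>n. A n)" for N .
  show "(\<Sum>n. upper (A n)) \<le> upper (\<Union>n. A n)"
    by (subst suminf_eq_SUP) (intro SUP_least *)
  show "upper (\<Union>n. A n) \<le> (\<Sum>n. upper (A n))"
  proof (rule upper_le)
    fix B assume B: "B \<in> sets borel" "B \<subseteq> (\<Union>n. A n)"
    have *: "(\<lambda>n. m (B \<inter> A n)) sums m (\<Union>n. B \<inter> A n)"
      using B meas by (intro sums_UN disjoint_family_on_bisimulation[OF assms(2)]) auto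
    have "(\<Union>n. B \<inter> A n) = B" using B by auto
    with * have sm: "(\<lambda>N. \<Sum>n<N. m (B \<inter> A n)) \<longlonglongrightarrow> m B"
      by (simp add: sums_def)
    have "(\<lambda>N. ennreal (\<Sum>n<N. m (B \<inter> A n))) \<longlonglongrightarrow> ennreal (m B)"
      using sm by (rule tendsto_ennrealI)
    moreover have "ennreal (\<Sum>n<N. m (B \<inter> A n)) \<le> (\<Sum>n. upper (A n))" for N
    proof -
      have "ennreal (\<Sum>n<N. m (B \<inter> A n)) \<le> ennreal (\<Sum>n<N. max 0 (m (B \<inter> A n)))"
        by (intro ennreal_leI sum_mono) auto
      also have "\<dots> = (\<Sum>n<N. ennreal (max 0 (m (B \<inter> A n))))"
        by (subst sum_ennreal) auto
      also have "\<dots> \<le> (\<Sum>n<N. upper (A n))"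
      proof (rule sum_mono)
        fix n
        have "ennreal (max 0 (m (B \<inter> A n))) = ennreal (m (B \<inter> A n))"
          by (auto simp: max_def ennreal_neg)
        thus "ennreal (max 0 (m (B \<inter> A n))) \<le> upper (A n)"
          using le_upper[of "B \<inter> A n" "A n"] B meas by auto
      qed
      also have "\<dots> \<le> (\<Sum>n. upper (A n))" by (rule sum_le_suminf) auto
      finally show ?thesis .
    qed
    ultimately show "ennreal (m B) \<le> (\<Sum>n. upper (A n))"
      by (intro LIMSEQ_le_const2) auto
  qed
qed

lemma emeasure_positive_variation:
  assumes "A \<in> sets borel"
  shows "emeasure (positive_variation m) A = upper A"
proof -
  have eq: "positive_variation m = measure_of UNIV (sets borel) upper"
    by (simp add: positive_variation_def upper_def[abs_def])
  show ?thesis unfolding eq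
  proof (rule emeasure_measure_of_sigma)
    show "sigma_algebra UNIV (sets (borel :: real measure))"
      by (metis sets.sigma_algebra_axioms space_borel)
    show "positive (sets borel) upper" by (simp add: positive_def)
    show "countably_additive (sets borel) upper"
      by (intro countably_additiveI upper_UN) auto
  qed fact
qed

text \<open>A subset \<open>B\<close> of very large measure leaves a complement of large negative measure, and one of the two
pieces inherits the infinite variation. The other one is \<open>E - E'\<close>.\<close>

lemma upper_split_infinite:
  assumes E: "E \<in> sets borel" "upper E = \<infinity>"
  shows "\<exists>E'. E' \<in> sets borel \<and> upper E' = \<infinity> \<and> E' \<subseteq> E \<and> 1 \<le> \<bar>m (E - E')\<bar>"
proof -
  have "\<not> upper E \<le> ennreal (\<bar>m E\<bar> + 1)" using E(2) by (metis ennreal_less_top infinity_ennreal_def not_le)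
  then obtain B where B: "B \<in> sets borel" "B \<subseteq> E" "\<not> ennreal (m B) \<le> ennreal (\<bar>m E\<bar> + 1)"
    using upper_le[of E "ennreal (\<bar>m E\<bar> + 1)"] by auto
  hence mB: "m B > \<bar>m E\<bar> + 1" by (metis ennreal_leI not_le)
  have mD: "m (E - B) = m E - m B" using E B by (intro diff) auto
  have "upper E \<le> upper B + upper (E - B)"
  proof (rule upper_le)
    fix C assume C: "C \<in> sets borel" "C \<subseteq> E"
    have "m C = m (C \<inter> B \<union> (C - B))" by (metis Int_Diff_Un)
    also have "\<dots> = m (C \<inter> B) + m (C - B)" using C B by (intro union) auto
    finally have "ennreal (m C) \<le> ennreal (m (C \<inter> B)) + ennreal (m (C - B))"
      by (cases "0 \<le> m (C \<inter> B)"; cases "0 \<le> m (C - B)")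
        (auto simp: ennreal_plus[symmetric] ennreal_neg intro!: ennreal_leI simp del: ennreal_plus)
    also have "\<dots> \<le> upper B + upper (E - B)"
      using C B E by (intro add_mono le_upper) auto
    finally show "ennreal (m C) \<le> upper B + upper (E - B)" .
  qed
  hence "upper B = \<infinity> \<or> upper (E - B) = \<infinity>"
    using E(2) by (simp add: top_unique)
  thus ?thesis
  proof
    assume "upper B = \<infinity>"
    thus ?thesis using B mB mD by (intro exI[of _ B]) auto
  next
    assume "upper (E - B) = \<infinity>"
    moreover have "E - (E - B) = B" using B by auto
    ultimately show ?thesis using B E mB by (intro exI[of _ "E - B"]) auto
  qed
qed

text \<open>Otherwise repeated splitting yields infinitely many disjoint sets with measures at least \<open>1\<close> in modulus,
and the series of their measures could not converge.\<close>

lemma upper_finite: "upper UNIV < \<infinity>"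
proof (rule ccontr)
  assume "\<not> upper UNIV < \<infinity>"
  hence inf: "upper UNIV = \<infinity>" by (simp add: less_top[symmetric])
  let ?P = "\<lambda>E. E \<in> sets borel \<and> upper E = \<infinity>"
  have "\<exists>E. \<forall>n::nat. ?P (E n) \<and> (E (Suc n) \<subseteq> E n \<and> 1 \<le> \<bar>m (E n - E (Suc n))\<bar>)"
    using inf upper_split_infinite
    by (intro dependent_nat_choice[where P = "\<lambda>_. ?P" and
          Q = "\<lambda>_ E E'. E' \<subseteq> E \<and> 1 \<le> \<bar>m (E - E')\<bar>"]) (auto intro: exI[of _ UNIV])
  then obtain E where E: "\<And>n::nat. E n \<in> sets borel" "\<And>n. E (Suc n) \<subseteq> E n"
    "\<And>n. 1 \<le> \<bar>m (E n - E (Suc n))\<bar>" by auto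
  have dec: "E k \<subseteq> E n" if "n \<le> k" for n k
    using that by (induction rule: dec_induct) (use E(2) in auto)
  have "disjoint_family (\<lambda>n. E n - E (Suc n))"
    unfolding disjoint_family_on_def
  proof (intro ballI impI)
    fix i j :: nat assume "i \<noteq> j"
    thus "(E i - E (Suc i)) \<inter> (E j - E (Suc j)) = {}"
      using dec[of "Suc i" j] dec[of "Suc j" i] by (cases i j rule: linorder_cases) auto
  qed
  hence "(\<lambda>n. m (E n - E (Suc n))) sums m (\<Union>n. E n - E (Suc n))"
    using E(1) by (intro sums_UN) auto
  hence "(\<lambda>n. m (E n - E (Suc n))) \<longlonglongrightarrow> 0"
    by (intro summable_LIMSEQ_zero sums_summable)
  hence "eventually (\<lambda>n. \<bar>m (E n - E (Suc n))\<bar> < 1) sequentially"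
    by (auto simp: tendsto_iff dest: spec[of _ 1])
  thus False using E(3) by (auto simp: eventually_sequentially not_less[symmetric])
qed

lemma uminus_signed: "signed_borel_measure (\<lambda>B. - m B)"
  by unfold_locales (auto intro: sums_minus sums_UN)

lemma sets_positive_variation [measurable_cong, simp]: "sets (positive_variation m) = sets borel"
  unfolding positive_variation_def by (metis sets.sets_measure_of_eq space_borel)

lemma finite_measure_positive_variation: "finite_measure (positive_variation m)"
proof
  have "space (positive_variation m) = UNIV"
    using sets_eq_imp_space_eq[OF sets_positive_variation] by simp
  thus "emeasure (positive_variation m) (space (positive_variation m)) \<noteq> \<infinity>"
    using upper_finite emeasure_positive_variation[of UNIV] by simp
qed

text \<open>As \<open>B\<close> runs through the measurable subsets of \<open>A\<close>, so does \<open>A - B\<close>. Hence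
\<open>m\<^sup>-(A) = sup (m (A - B) - m A) = m\<^sup>+(A) - m A\<close> directly from the definition of the positive variation.\<close>

lemma jordan_decomposition:
  assumes "A \<in> sets borel"
  shows "measure (positive_variation m) A - measure (positive_variation (\<lambda>B. - m B)) A = m A"
proof -
  interpret n: signed_borel_measure "\<lambda>B. - m B" by (rule uminus_signed)
  interpret P: finite_measure "positive_variation m" by (rule finite_measure_positive_variation)
  interpret N: finite_measure "positive_variation (\<lambda>B. - m B)" by (rule n.finite_measure_positive_variation)
  let ?p = "measure (positive_variation m) A" and ?n = "measure (positive_variation (\<lambda>B. - m B)) A"
  have p: "upper A = ennreal ?p"
    using emeasure_positive_variation[OF assms] by (simp add: P.emeasure_eq_measure)
  have n: "n.upper A = ennreal ?n"
    using n.emeasure_positive_variation[OF assms] by (simp add: N.emeasure_eq_measure)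
  have mp: "m B \<le> ?p" if "B \<in> sets borel" "B \<subseteq> A" for B
    using le_upper[OF that] p by (auto simp: ennreal_le_iff2 intro: order_trans[OF _ measure_nonneg])
  have mn: "- m B \<le> ?n" if "B \<in> sets borel" "B \<subseteq> A" for B
    using n.le_upper[OF that] n by (auto simp: ennreal_le_iff2 intro: order_trans[OF _ measure_nonneg])
  have d: "A - B \<in> sets borel \<and> A - B \<subseteq> A \<and> m (A - B) = m A - m B" if "B \<in> sets borel" "B \<subseteq> A" for B
    using that assms diff by auto
  have "upper A \<le> ennreal (?n + m A)"
    using mn d by (intro upper_le ennreal_leI) (smt (verit))
  moreover have "0 \<le> ?n + m A" using mn[OF assms] by simp
  ultimately have "?p \<le> ?n + m A" using p by (simp add: ennreal_le_iff)
  have "n.upper A \<le> ennreal (?p - m A)"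
    using mp d by (intro n.upper_le ennreal_leI) (smt (verit))
  moreover have "0 \<le> ?p - m A" using mp[OF assms] by simp
  ultimately have "?n \<le> ?p - m A" using n by (simp add: ennreal_le_iff)
  with \<open>?p \<le> ?n + m A\<close> show ?thesis by simp
qed

end


section \<open>Complex measures as functionals on bounded Borel functions\<close>

definition bounded_borel :: "(real \<Rightarrow> complex) set" where
  "bounded_borel = {f \<in> borel_measurable borel. bounded (range f)}"

lemma bounded_borelI:
  assumes "f \<in> borel_measurable borel" "\<And>x. cmod (f x) \<le> B"
  shows "f \<in> bounded_borel"
  using assms by (auto simp: bounded_borel_def bounded_iff)

lemma bounded_borelE:
  assumes "f \<in> bounded_borel"
  obtains B where "f \<in> borel_measurable borel" "0 \<le> B" "\<And>x. cmod (f x) \<le> B"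
proof -
  obtain B where "\<forall>x. cmod (f x) \<le> B" using assms by (auto simp: bounded_borel_def bounded_iff)
  moreover from this have "0 \<le> B" using norm_ge_zero order_trans by blast
  ultimately show ?thesis using assms that[of B] by (auto simp: bounded_borel_def)
qed

lemma bounded_borel_add:
  assumes "f \<in> bounded_borel" "g \<in> bounded_borel"
  shows "(\<lambda>x. f x + g x) \<in> bounded_borel"
proof -
  obtain B where B: "f \<in> borel_measurable borel" "\<And>x. cmod (f x) \<le> B" using bounded_borelE[OF assms(1)] by metis
  obtain C where C: "g \<in> borel_measurable borel" "\<And>x. cmod (g x) \<le> C" using bounded_borelE[OF assms(2)] by metis
  show ?thesis
    using B C by (intro bounded_borelI[where B = "B + C"]) (auto intro!: norm_triangle_mono)
qed

lemma bounded_borel_scale: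
  assumes "f \<in> bounded_borel"
  shows "(\<lambda>x. c * f x) \<in> bounded_borel"
proof -
  obtain B where B: "f \<in> borel_measurable borel" "\<And>x. cmod (f x) \<le> B" using bounded_borelE[OF assms] by metis
  show ?thesis
    using B by (intro bounded_borelI[where B = "cmod c * B"]) (auto simp: norm_mult intro!: mult_left_mono)
qed

lemma bounded_borel_shift:
  assumes "f \<in> bounded_borel"
  shows "(\<lambda>x. f (x + t)) \<in> bounded_borel"
proof -
  obtain B where B: "f \<in> borel_measurable borel" "\<And>x. cmod (f x) \<le> B" using bounded_borelE[OF assms] by metis
  note [measurable] = B(1)
  show ?thesis using B by (intro bounded_borelI[where B = B]) auto
qed

lemma bounded_borel_indicator: "A \<in> sets borel \<Longrightarrow> indicator A \<in> bounded_borel"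
  by (intro bounded_borelI[where B = 1]) (auto simp: indicator_def)

lemma bounded_borel_sum:
  assumes "finite S" "\<And>i. i \<in> S \<Longrightarrow> f i \<in> bounded_borel"
  shows "(\<lambda>x. \<Sum>i\<in>S. f i x) \<in> bounded_borel"
  using assms
proof (induction S rule: finite_induct)
  case empty
  show ?case by (intro bounded_borelI[where B = 0]) auto
qed (auto intro: bounded_borel_add)

text \<open>Linear functionals on the bounded Borel functions that are continuous under bounded pointwise
convergence. They are exactly the integrals against complex measures
(\<open>measure_functional_representation\<close>), but are easier to build: the integral against a convolution, for
instance, can be written down at once.\<close>

definition measure_functional :: "((real \<Rightarrow> complex) \<Rightarrow> complex) \<Rightarrow> bool" where
  "measure_functional \<Phi> \<longleftrightarrow>
     (\<forall>f\<in>bounded_borel. \<forall>g\<in>bounded_borel. \<Phi> (\<lambda>x. f x + g x) = \<Phi> f + \<Phi> g) \<and>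
     (\<forall>f\<in>bounded_borel. \<forall>c. \<Phi> (\<lambda>x. c * f x) = c * \<Phi> f) \<and>
     (\<forall>f g B. (\<forall>n::nat. f n \<in> bounded_borel) \<longrightarrow> (\<forall>n x. cmod (f n x) \<le> B) \<longrightarrow>
        (\<forall>x. (\<lambda>n. f n x) \<longlonglongrightarrow> g x) \<longrightarrow> (\<lambda>n. \<Phi> (f n)) \<longlonglongrightarrow> \<Phi> g)"

lemma measure_functional_add:
  "measure_functional \<Phi> \<Longrightarrow> f \<in> bounded_borel \<Longrightarrow> g \<in> bounded_borel \<Longrightarrow> \<Phi> (\<lambda>x. f x + g x) = \<Phi> f + \<Phi> g"
  by (simp add: measure_functional_def)

lemma measure_functional_scale:
  "measure_functional \<Phi> \<Longrightarrow> f \<in> bounded_borel \<Longrightarrow> \<Phi> (\<lambda>x. c * f x) = c * \<Phi> f"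
  by (simp add: measure_functional_def)

lemma measure_functional_lim:
  assumes "measure_functional \<Phi>" "\<And>n::nat. f n \<in> bounded_borel" "\<And>n x. cmod (f n x) \<le> B"
    "\<And>x. (\<lambda>n. f n x) \<longlonglongrightarrow> g x"
  shows "(\<lambda>n. \<Phi> (f n)) \<longlonglongrightarrow> \<Phi> g"
  using assms unfolding measure_functional_def by blast

lemma measure_functional_sum:
  assumes \<Phi>: "measure_functional \<Phi>" and "finite S" "\<And>i. i \<in> S \<Longrightarrow> f i \<in> bounded_borel"
  shows "\<Phi> (\<lambda>x. \<Sum>i\<in>S. f i x) = (\<Sum>i\<in>S. \<Phi> (f i))"
  using assms(2,3)
proof (induction S rule: finite_induct)
  case empty
  have "(\<lambda>x. 0) \<in> bounded_borel" by (intro bounded_borelI[where B = 0]) auto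
  from measure_functional_scale[OF \<Phi> this, of 0] show ?case by simp
next
  case (insert i S)
  thus ?case using measure_functional_add[OF \<Phi>, of "f i" "\<lambda>x. \<Sum>i\<in>S. f i x"] bounded_borel_sum[of S f] by simp
qed

text \<open>The indicators determine the functional on simple functions, and every bounded Borel function is a
bounded pointwise limit of simple ones.\<close>

lemma measure_functional_ext:
  assumes \<Phi>: "measure_functional \<Phi>" and \<Psi>: "measure_functional \<Psi>"
    and eq: "\<And>A. A \<in> sets borel \<Longrightarrow> \<Phi> (indicator A) = \<Psi> (indicator A)"
    and f: "f \<in> bounded_borel"
  shows "\<Phi> f = \<Psi> f"
proof -
  obtain B where B: "f \<in> borel_measurable borel" "\<And>x. cmod (f x) \<le> B" using bounded_borelE[OF f] by metis
  obtain s where s: "\<And>i. simple_function borel (s i)" "\<And>x. (\<lambda>i. s i x) \<longlonglongrightarrow> f x"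
      "\<And>i x. cmod (s i x) \<le> 2 * cmod (f x)"
    using borel_measurable_implies_sequence_metric[OF B(1), of 0] by auto
  have simple: "s i \<in> bounded_borel \<and> \<Phi> (s i) = \<Psi> (s i)" for i
  proof -
    let ?g = "\<lambda>y x. y * indicator (s i -` {y}) x :: complex"
    have fin: "finite (range (s i))" using s(1)[of i] by (simp add: simple_function_def)
    have rep: "s i = (\<lambda>x. \<Sum>y\<in>range (s i). ?g y x)"
    proof
      fix x
      have "(\<Sum>y\<in>range (s i). ?g y x) = (\<Sum>y\<in>range (s i). if y = s i x then y else 0)"
        by (intro sum.cong) (auto simp: indicator_def)
      also have "\<dots> = s i x" using fin by (subst sum.delta) auto
      finally show "s i x = (\<Sum>y\<in>range (s i). ?g y x)" by simp
    qed
    have meas: "s i -` {y} \<in> sets borel" for y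
      using measurable_sets[OF borel_measurable_simple_function[OF s(1)[of i]], of "{y}"] by simp
    have bb: "?g y \<in> bounded_borel" for y
      using meas by (intro bounded_borel_scale bounded_borel_indicator)
    have "\<Phi> (\<lambda>x. \<Sum>y\<in>range (s i). ?g y x) = \<Psi> (\<lambda>x. \<Sum>y\<in>range (s i). ?g y x)"
      using meas eq
      by (simp add: measure_functional_sum[OF \<Phi> fin bb] measure_functional_sum[OF \<Psi> fin bb]
        measure_functional_scale[OF \<Phi>] measure_functional_scale[OF \<Psi>] bounded_borel_indicator)
    moreover have "(\<lambda>x. \<Sum>y\<in>range (s i). ?g y x) \<in> bounded_borel"
      using fin bb by (rule bounded_borel_sum)
    ultimately show ?thesis by (subst (1 2 3) rep) simp
  qed
  have bound: "cmod (s i x) \<le> 2 * B" for i x using s(3)[of i x] B(2)[of x] by simp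
  have "(\<lambda>i. \<Phi> (s i)) \<longlonglongrightarrow> \<Phi> f"
    by (rule measure_functional_lim[OF \<Phi> _ bound s(2)]) (use simple in blast)
  moreover have "(\<lambda>i. \<Psi> (s i)) \<longlonglongrightarrow> \<Psi> f"
    by (rule measure_functional_lim[OF \<Psi> _ bound s(2)]) (use simple in blast)
  ultimately show ?thesis using simple by (simp add: LIMSEQ_unique)
qed

lemma measure_functional_complex_measure:
  assumes \<Phi>: "measure_functional \<Phi>"
  shows "(\<lambda>A. \<Phi> (indicator A)) \<in> complex_borel_measures"
  unfolding complex_borel_measures_def
proof (intro CollectI allI impI)
  fix A :: "nat \<Rightarrow> real set" assume A: "range A \<subseteq> sets borel" "disjoint_family A"
  have eq: "(\<Sum>n<N. indicator (A n) x :: complex) = indicator (\<Union>n<N. A n) x" for N x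
    using A(2) by (intro indicator_UN_disjoint[symmetric]) (auto simp: disjoint_family_on_def)
  have "(\<lambda>N. \<Phi> (\<lambda>x. \<Sum>n<N. indicator (A n) x)) \<longlonglongrightarrow> \<Phi> (indicator (\<Union>n. A n))"
  proof (rule measure_functional_lim[OF \<Phi>])
    show "(\<lambda>x. \<Sum>n<N. indicator (A n) x) \<in> bounded_borel" for N
      using A(1) by (intro bounded_borel_sum bounded_borel_indicator) auto
    show "cmod (\<Sum>n<N. indicator (A n) x) \<le> 1" for N x
      unfolding eq by (auto simp: indicator_def)
    show "(\<lambda>N. \<Sum>n<N. indicator (A n) x :: complex) \<longlonglongrightarrow> indicator (\<Union>n. A n) x" for x
      unfolding eq by (rule LIMSEQ_indicator_UN)
  qed
  also have "(\<lambda>N. \<Phi> (\<lambda>x. \<Sum>n<N. indicator (A n) x)) = (\<lambda>N. \<Sum>n<N. \<Phi> (indicator (A n)))"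
    using A(1) by (intro ext measure_functional_sum[OF \<Phi>] bounded_borel_indicator) auto
  finally show "(\<lambda>n. \<Phi> (indicator (A n))) sums \<Phi> (indicator (\<Union>n. A n))"
    by (simp add: sums_def)
qed

text \<open>Reduces every statement about \<^const>\<open>complex_integral\<close> to four finite positive measures.\<close>

lemma complex_integral_decomposition:
  assumes "\<mu> \<in> complex_borel_measures"
  obtains P N P' N' where "\<And>M. M \<in> {P, N, P', N'} \<Longrightarrow> finite_measure M \<and> sets M = sets borel"
    and "\<And>f. complex_integral \<mu> f =
      (LINT x|P. f x) - (LINT x|N. f x) + \<i> * ((LINT x|P'. f x) - (LINT x|N'. f x))"
    and "\<And>A. A \<in> sets borel \<Longrightarrow> \<mu> A =
      of_real (measure P A) - of_real (measure N A) + \<i> * (of_real (measure P' A) - of_real (measure N' A))"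
proof -
  interpret R: signed_borel_measure "\<lambda>B. Re (\<mu> B)"
    using assms by unfold_locales (auto simp: complex_borel_measures_def intro: sums_Re)
  interpret I: signed_borel_measure "\<lambda>B. Im (\<mu> B)"
    using assms by unfold_locales (auto simp: complex_borel_measures_def intro: sums_Im)
  interpret R': signed_borel_measure "\<lambda>B. - Re (\<mu> B)" by (rule R.uminus_signed)
  interpret I': signed_borel_measure "\<lambda>B. - Im (\<mu> B)" by (rule I.uminus_signed)
  show thesis
  proof (rule that)
    fix M assume "M \<in> {positive_variation (\<lambda>B. Re (\<mu> B)), positive_variation (\<lambda>B. - Re (\<mu> B)),
        positive_variation (\<lambda>B. Im (\<mu> B)), positive_variation (\<lambda>B. - Im (\<mu> B))}"
    thus "finite_measure M \<and> sets M = sets borel"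
      using R.finite_measure_positive_variation R'.finite_measure_positive_variation
        I.finite_measure_positive_variation I'.finite_measure_positive_variation by auto
  next
    fix f show "complex_integral \<mu> f = (LINT x|positive_variation (\<lambda>B. Re (\<mu> B)). f x) -
      (LINT x|positive_variation (\<lambda>B. - Re (\<mu> B)). f x) + \<i> * ((LINT x|positive_variation (\<lambda>B. Im (\<mu> B)). f x) -
      (LINT x|positive_variation (\<lambda>B. - Im (\<mu> B)). f x))"
      by (simp add: complex_integral_def signed_integral_def)
  next
    fix A :: "real set" assume A: "A \<in> sets borel"
    show "\<mu> A = of_real (measure (positive_variation (\<lambda>B. Re (\<mu> B))) A)
      - of_real (measure (positive_variation (\<lambda>B. - Re (\<mu> B))) A)
      + \<i> * (of_real (measure (positive_variation (\<lambda>B. Im (\<mu> B))) A)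
        - of_real (measure (positive_variation (\<lambda>B. - Im (\<mu> B))) A))"
      using R.jordan_decomposition[OF A] I.jordan_decomposition[OF A] by (simp add: complex_eq_iff)
  qed
qed

lemma integrable_bounded_borel:
  assumes "finite_measure M" "sets M = sets borel" "f \<in> bounded_borel"
  shows "integrable M f"
proof -
  obtain B where B: "f \<in> borel_measurable borel" "\<And>x. cmod (f x) \<le> B" using bounded_borelE[OF assms(3)] by metis
  have "f \<in> borel_measurable M"
    using B(1) by (simp add: measurable_cong_sets[OF assms(2) refl])
  thus ?thesis
    using B(2) by (intro finite_measure.integrable_const_bound[OF assms(1)] AE_I2)
qed

lemma measure_functional_integral:
  assumes M: "finite_measure M" "sets M = sets borel"
  shows "measure_functional (\<lambda>f. LINT x|M. f x)"
  unfolding measure_functional_def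
proof (intro conjI ballI allI impI)
  interpret finite_measure M by fact
  note int = integrable_bounded_borel[OF M]
  show "(LINT x|M. f x + g x) = (LINT x|M. f x) + (LINT x|M. g x)"
    if "f \<in> bounded_borel" "g \<in> bounded_borel" for f g using int that by simp
  show "(LINT x|M. c * f x) = c * (LINT x|M. f x)" if "f \<in> bounded_borel" for f c by simp
  fix f :: "nat \<Rightarrow> real \<Rightarrow> complex" and g B
  assume f: "\<forall>n. f n \<in> bounded_borel" "\<forall>n x. cmod (f n x) \<le> B" "\<forall>x. (\<lambda>n. f n x) \<longlonglongrightarrow> g x"
  have meas: "f n \<in> borel_measurable M" for n
    by (intro borel_measurable_integrable int) (use f(1) in simp)
  have "g \<in> borel_measurable M"
    using f(3) by (intro borel_measurable_LIMSEQ_metric[OF meas]) auto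
  thus "(\<lambda>n. LINT x|M. f n x) \<longlonglongrightarrow> (LINT x|M. g x)"
    using f meas by (intro integral_dominated_convergence[where w = "\<lambda>_. B"]) auto
qed

lemma measure_functional_combine:
  assumes "measure_functional \<Phi>" "measure_functional \<Psi>"
  shows "measure_functional (\<lambda>f. a * \<Phi> f + b * \<Psi> f)"
  unfolding measure_functional_def
proof (intro conjI ballI allI impI)
  note [simp] = measure_functional_add[OF assms(1)] measure_functional_add[OF assms(2)]
    measure_functional_scale[OF assms(1)] measure_functional_scale[OF assms(2)]
  show "a * \<Phi> (\<lambda>x. f x + g x) + b * \<Psi> (\<lambda>x. f x + g x) = a * \<Phi> f + b * \<Psi> f + (a * \<Phi> g + b * \<Psi> g)"
    if "f \<in> bounded_borel" "g \<in> bounded_borel" for f g using that by (simp add: algebra_simps)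
  show "a * \<Phi> (\<lambda>x. c * f x) + b * \<Psi> (\<lambda>x. c * f x) = c * (a * \<Phi> f + b * \<Psi> f)"
    if "f \<in> bounded_borel" for f c using that by (simp add: algebra_simps)
  fix f :: "nat \<Rightarrow> real \<Rightarrow> complex" and g B
  assume f: "\<forall>n. f n \<in> bounded_borel" "\<forall>n x. cmod (f n x) \<le> B" "\<forall>x. (\<lambda>n. f n x) \<longlonglongrightarrow> g x"
  show "(\<lambda>n. a * \<Phi> (f n) + b * \<Psi> (f n)) \<longlonglongrightarrow> a * \<Phi> g + b * \<Psi> g"
    using f by (intro tendsto_add tendsto_mult_left measure_functional_lim[OF assms(1), where B = B]
        measure_functional_lim[OF assms(2), where B = B]) auto
qed

lemma measure_functional_complex_integral:
  assumes "\<mu> \<in> complex_borel_measures"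
  shows "measure_functional (complex_integral \<mu>)"
proof -
  obtain P N P' N' where M: "\<And>M. M \<in> {P, N, P', N'} \<Longrightarrow> finite_measure M \<and> sets M = sets borel"
    and ci: "\<And>f. complex_integral \<mu> f =
      (LINT x|P. f x) - (LINT x|N. f x) + \<i> * ((LINT x|P'. f x) - (LINT x|N'. f x))"
    by (rule complex_integral_decomposition[OF assms]) blast
  have mf: "measure_functional (\<lambda>f. LINT x|M. f x)" if "M \<in> {P, N, P', N'}" for M
    using M[OF that] by (intro measure_functional_integral) auto
  have "measure_functional (\<lambda>f. 1 * (1 * (LINT x|P. f x) + (-1) * (LINT x|N. f x))
      + \<i> * (1 * (LINT x|P'. f x) + (-1) * (LINT x|N'. f x)))"
    by (intro measure_functional_combine mf) auto
  moreover have "complex_integral \<mu> = (\<lambda>f. 1 * (1 * (LINT x|P. f x) + (-1) * (LINT x|N. f x))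
      + \<i> * (1 * (LINT x|P'. f x) + (-1) * (LINT x|N'. f x)))"
    by (rule ext) (simp add: ci)
  ultimately show ?thesis by simp
qed

lemma complex_integral_indicator:
  assumes "\<mu> \<in> complex_borel_measures" "A \<in> sets borel"
  shows "complex_integral \<mu> (indicator A) = \<mu> A"
proof -
  obtain P N P' N' where M: "\<And>M. M \<in> {P, N, P', N'} \<Longrightarrow> finite_measure M \<and> sets M = sets borel"
    and ci: "\<And>f. complex_integral \<mu> f =
      (LINT x|P. f x) - (LINT x|N. f x) + \<i> * ((LINT x|P'. f x) - (LINT x|N'. f x))"
    and \<mu>: "\<And>A. A \<in> sets borel \<Longrightarrow> \<mu> A =
      of_real (measure P A) - of_real (measure N A) + \<i> * (of_real (measure P' A) - of_real (measure N' A))"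
    by (rule complex_integral_decomposition[OF assms(1)]) blast
  have "(LINT x|M. indicator A x :: complex) = of_real (measure M A)" if "M \<in> {P, N, P', N'}" for M
  proof -
    interpret finite_measure M using M[OF that] by simp
    have "A \<in> sets M" using M[OF that] assms(2) by simp
    have "(LINT x|M. indicator A x :: complex) = (LINT x|M. complex_of_real (indicator A x))"
      by (intro Bochner_Integration.integral_cong) (auto simp: indicator_def)
    also have "\<dots> = complex_of_real (LINT x|M. indicator A x)" by (rule integral_complex_of_real)
    also have "(LINT x|M. indicator A x :: real) = measure M A"
      using \<open>A \<in> sets M\<close> sets.sets_into_space by (simp add: Int_absorb2)
    finally show ?thesis .
  qed
  thus ?thesis using \<mu>[OF assms(2)] by (simp add: ci)
qed

text \<open>Both sides are functionals continuous under bounded convergence, and they agree on indicators.\<close>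

lemma measure_functional_representation:
  assumes "measure_functional \<Phi>" "f \<in> bounded_borel"
  shows "complex_integral (\<lambda>A. \<Phi> (indicator A)) f = \<Phi> f"
proof (rule measure_functional_ext[OF _ assms(1) _ assms(2)])
  note cm = measure_functional_complex_measure[OF assms(1)]
  show "measure_functional (complex_integral (\<lambda>A. \<Phi> (indicator A)))"
    by (rule measure_functional_complex_integral[OF cm])
  show "complex_integral (\<lambda>A. \<Phi> (indicator A)) (indicator A) = \<Phi> (indicator A)"
    if "A \<in> sets borel" for A
    by (rule complex_integral_indicator[OF cm that])
qed


section \<open>The Fourier--Stieltjes algebra\<close>

definition character :: "real \<Rightarrow> real \<Rightarrow> complex" where
  "character \<xi> x = exp (\<i> * complex_of_real (\<xi> * x))"

lemma character_cis: "character \<xi> x = cis (\<xi> * x)"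
  unfolding character_def cis_conv_exp ..

lemma cmod_character [simp]: "cmod (character \<xi> x) = 1"
  unfolding character_def by (rule norm_exp_i_times)

lemma character_add: "character \<xi> (x + y) = character \<xi> x * character \<xi> y"
  by (simp add: character_def exp_add[symmetric] algebra_simps)

lemma continuous_on_character: "continuous_on UNIV (character \<xi>)"
  unfolding character_def by (intro continuous_intros)

lemma character_bounded_borel: "character \<xi> \<in> bounded_borel"
  by (intro bounded_borelI[where B = 1] borel_measurable_continuous_onI continuous_on_character) simp

lemma fourier_stieltjes_character: "fourier_stieltjes \<mu> \<xi> = complex_integral \<mu> (character \<xi>)"
  by (simp add: fourier_stieltjes_def character_def[abs_def])

text \<open>The only way in which new elements of \<^const>\<open>B_alg\<close> are produced below.\<close>

lemma B_alg_of_functional: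
  assumes "measure_functional \<Phi>"
  shows "(\<lambda>\<xi>. \<Phi> (character \<xi>)) \<in> B_alg"
proof -
  have "fourier_stieltjes (\<lambda>A. \<Phi> (indicator A)) = (\<lambda>\<xi>. \<Phi> (character \<xi>))"
    using measure_functional_representation[OF assms character_bounded_borel]
    by (simp add: fourier_stieltjes_character fun_eq_iff)
  thus ?thesis
    unfolding B_alg_def using measure_functional_complex_measure[OF assms] by (metis image_eqI)
qed

lemma B_algE:
  assumes "G \<in> B_alg"
  obtains \<mu> where "\<mu> \<in> complex_borel_measures" "G = (\<lambda>\<xi>. complex_integral \<mu> (character \<xi>))"
  using assms unfolding B_alg_def by (auto simp: fourier_stieltjes_character fun_eq_iff)

lemma B_alg_combine:
  assumes "G \<in> B_alg" "H \<in> B_alg"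
  shows "(\<lambda>\<xi>. a * G \<xi> + b * H \<xi>) \<in> B_alg"
proof -
  obtain \<mu> \<nu> where "\<mu> \<in> complex_borel_measures" "\<nu> \<in> complex_borel_measures"
    and eq: "G = (\<lambda>\<xi>. complex_integral \<mu> (character \<xi>))" "H = (\<lambda>\<xi>. complex_integral \<nu> (character \<xi>))"
    using B_algE[OF assms(1)] B_algE[OF assms(2)] by metis
  hence "measure_functional (\<lambda>f. a * complex_integral \<mu> f + b * complex_integral \<nu> f)"
    by (intro measure_functional_combine measure_functional_complex_integral)
  from B_alg_of_functional[OF this] show ?thesis by (simp add: eq)
qed

lemma B_alg_continuous:
  assumes "G \<in> B_alg"
  shows "continuous_on UNIV G"
proof -
  obtain \<mu> where \<mu>: "\<mu> \<in> complex_borel_measures" and G: "G = (\<lambda>\<xi>. complex_integral \<mu> (character \<xi>))"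
    using B_algE[OF assms] by metis
  have "(\<lambda>n. G (u n)) \<longlonglongrightarrow> G \<xi>" if "u \<longlonglongrightarrow> \<xi>" for u \<xi>
    unfolding G
  proof (rule measure_functional_lim[OF measure_functional_complex_integral[OF \<mu>]])
    show "character (u n) \<in> bounded_borel" for n by (rule character_bounded_borel)
    show "cmod (character (u n) x) \<le> 1" for n x by simp
    show "(\<lambda>n. character (u n) x) \<longlonglongrightarrow> character \<xi> x" for x
      unfolding character_def using that by (intro tendsto_intros)
  qed
  thus ?thesis
    by (auto simp: continuous_on_sequentially o_def)
qed

lemma complex_integral_norm_bound:
  assumes "\<mu> \<in> complex_borel_measures"
  obtains C where "\<And>f B. f \<in> bounded_borel \<Longrightarrow> (\<And>x. cmod (f x) \<le> B) \<Longrightarrow> cmod (complex_integral \<mu> f) \<le> C * B"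
proof -
  obtain P N P' N' where M: "\<And>M. M \<in> {P, N, P', N'} \<Longrightarrow> finite_measure M \<and> sets M = sets borel"
    and ci: "\<And>f. complex_integral \<mu> f =
      (LINT x|P. f x) - (LINT x|N. f x) + \<i> * ((LINT x|P'. f x) - (LINT x|N'. f x))"
    by (rule complex_integral_decomposition[OF assms]) blast
  let ?c = "\<lambda>M. measure M (space M)"
  show thesis
  proof (rule that)
    fix f B assume f: "f \<in> bounded_borel" "\<And>x. cmod (f x) \<le> B"
    have bd: "cmod (LINT x|M. f x) \<le> ?c M * B" if "M \<in> {P, N, P', N'}" for M
    proof -
      interpret finite_measure M using M[OF that] by simp
      have int: "integrable M f" using M[OF that] f(1) by (intro integrable_bounded_borel) auto
      have "cmod (LINT x|M. f x) \<le> (LINT x|M. cmod (f x))" by (rule integral_norm_bound)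
      also have "\<dots> \<le> (LINT x|M. B)" using int f(2) by (intro integral_mono) auto
      finally show ?thesis by simp
    qed
    have "cmod (complex_integral \<mu> f)
        \<le> cmod (LINT x|P. f x) + cmod (LINT x|N. f x) + (cmod (LINT x|P'. f x) + cmod (LINT x|N'. f x))"
      unfolding ci
      by (intro norm_triangle_mono norm_triangle_ineq4) (simp add: norm_mult norm_triangle_ineq4)
    also have "\<dots> \<le> ?c P * B + ?c N * B + (?c P' * B + ?c N' * B)"
      by (intro add_mono bd) auto
    finally show "cmod (complex_integral \<mu> f) \<le> (?c P + ?c N + ?c P' + ?c N') * B"
      by (simp add: algebra_simps)
  qed
qed

lemma complex_integral_shift_measurable:
  assumes "\<mu> \<in> complex_borel_measures" "f \<in> bounded_borel"
  shows "(\<lambda>t. complex_integral \<mu> (\<lambda>x. f (x + t))) \<in> borel_measurable borel"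
proof -
  obtain P N P' N' where M: "\<And>M. M \<in> {P, N, P', N'} \<Longrightarrow> finite_measure M \<and> sets M = sets borel"
    and ci: "\<And>f. complex_integral \<mu> f =
      (LINT x|P. f x) - (LINT x|N. f x) + \<i> * ((LINT x|P'. f x) - (LINT x|N'. f x))"
    by (rule complex_integral_decomposition[OF assms(1)]) blast
  have [measurable]: "f \<in> borel_measurable borel" using assms(2) by (simp add: bounded_borel_def)
  have meas: "(\<lambda>t. LINT x|M. f (x + t)) \<in> borel_measurable borel" if "M \<in> {P, N, P', N'}" for M
  proof -
    interpret finite_measure M using M[OF that] by simp
    have [measurable_cong]: "sets M = sets borel" using M[OF that] by simp
    show ?thesis by (intro borel_measurable_lebesgue_integral) measurable
  qed
  have [measurable]: "(\<lambda>t. LINT x|P. f (x + t)) \<in> borel_measurable borel" by (rule meas) simp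
  have [measurable]: "(\<lambda>t. LINT x|N. f (x + t)) \<in> borel_measurable borel" by (rule meas) simp
  have [measurable]: "(\<lambda>t. LINT x|P'. f (x + t)) \<in> borel_measurable borel" by (rule meas) simp
  have [measurable]: "(\<lambda>t. LINT x|N'. f (x + t)) \<in> borel_measurable borel" by (rule meas) simp
  show ?thesis unfolding ci by measurable
qed

text \<open>The integral against the convolution of \<open>\<mu>\<close> with the density \<open>w\<close>. Dominated convergence in \<open>t\<close> reduces
continuity under bounded convergence to that of \<open>\<mu>\<close>.\<close>

lemma measure_functional_convolution:
  assumes \<mu>: "\<mu> \<in> complex_borel_measures" and w: "integrable lborel w"
  shows "measure_functional (\<lambda>f. LINT t|lborel. w t * complex_integral \<mu> (\<lambda>x. f (x + t)))"
  unfolding measure_functional_def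
proof (intro conjI ballI allI impI)
  let ?I = "\<lambda>f t. complex_integral \<mu> (\<lambda>x. f (x + t))"
  note mf = measure_functional_complex_integral[OF \<mu>]
  obtain C where C: "\<And>f B. f \<in> bounded_borel \<Longrightarrow> (\<And>x. cmod (f x) \<le> B) \<Longrightarrow> cmod (complex_integral \<mu> f) \<le> C * B"
    using complex_integral_norm_bound[OF \<mu>] by metis
  have bd: "cmod (?I f t) \<le> C * B" if "f \<in> bounded_borel" "\<And>x. cmod (f x) \<le> B" for f B t
    using that by (intro C bounded_borel_shift)
  have dom: "cmod (w t * ?I f t) \<le> C * B * cmod (w t)" if "f \<in> bounded_borel" "\<And>x. cmod (f x) \<le> B" for f B t
    using mult_right_mono[OF bd[OF that], of "cmod (w t)" t] by (simp add: norm_mult mult.commute)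
  have [measurable]: "w \<in> borel_measurable borel" using w by (auto dest: borel_measurable_integrable)
  have meas: "(\<lambda>t. w t * ?I f t) \<in> borel_measurable lborel" if "f \<in> bounded_borel" for f
    using complex_integral_shift_measurable[OF \<mu> that] by simp
  have int: "integrable lborel (\<lambda>t. w t * ?I f t)" if f: "f \<in> bounded_borel" for f
  proof -
    obtain B where B: "\<And>x. cmod (f x) \<le> B" using bounded_borelE[OF f] by metis
    show ?thesis
    proof (rule Bochner_Integration.integrable_bound[OF _ meas[OF f]])
      show "integrable lborel (\<lambda>t. C * B * cmod (w t))" using w by simp
      show "AE t in lborel. cmod (w t * ?I f t) \<le> norm (C * B * cmod (w t))"
        using dom[OF f B] by (intro AE_I2) (simp add: order_trans[OF _ abs_ge_self])
    qed
  qed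
  show "(LINT t|lborel. w t * complex_integral \<mu> (\<lambda>x. f (x + t) + g (x + t)))
      = (LINT t|lborel. w t * ?I f t) + (LINT t|lborel. w t * ?I g t)"
    if "f \<in> bounded_borel" "g \<in> bounded_borel" for f g
    using that by (simp add: measure_functional_add[OF mf] bounded_borel_shift distrib_left int)
  show "(LINT t|lborel. w t * complex_integral \<mu> (\<lambda>x. c * f (x + t))) = c * (LINT t|lborel. w t * ?I f t)"
    if "f \<in> bounded_borel" for f c
    using that by (simp add: measure_functional_scale[OF mf] bounded_borel_shift mult.left_commute)
  fix f :: "nat \<Rightarrow> real \<Rightarrow> complex" and g B
  assume f: "\<forall>n. f n \<in> bounded_borel" "\<forall>n x. cmod (f n x) \<le> B" "\<forall>x. (\<lambda>n. f n x) \<longlonglongrightarrow> g x"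
  have fn: "f n \<in> bounded_borel" and fB: "cmod (f n x) \<le> B" and fg: "(\<lambda>n. f n x) \<longlonglongrightarrow> g x" for n x
    using f by simp_all
  have g: "g \<in> bounded_borel"
  proof (rule bounded_borelI)
    show "g \<in> borel_measurable borel"
    proof (rule borel_measurable_LIMSEQ_metric)
      show "f n \<in> borel_measurable borel" for n using fn[of n] by (simp add: bounded_borel_def)
    qed (rule fg)
    show "cmod (g x) \<le> B" for x
      by (rule LIMSEQ_le_const2[OF tendsto_norm[OF fg]]) (simp add: fB)
  qed
  show "(\<lambda>n. LINT t|lborel. w t * ?I (f n) t) \<longlonglongrightarrow> (LINT t|lborel. w t * ?I g t)"
  proof (rule integral_dominated_convergence)
    show "integrable lborel (\<lambda>t. C * B * cmod (w t))" using w by simp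
    show "(\<lambda>t. w t * ?I g t) \<in> borel_measurable lborel" using g by (rule meas)
    show "(\<lambda>t. w t * ?I (f n) t) \<in> borel_measurable lborel" for n by (intro meas fn)
    show "AE t in lborel. (\<lambda>n. w t * ?I (f n) t) \<longlonglongrightarrow> w t * ?I g t"
      by (intro AE_I2 tendsto_mult_left measure_functional_lim[OF mf, where B = B] bounded_borel_shift fn fB fg)
    show "AE t in lborel. cmod (w t * ?I (f n) t) \<le> C * B * cmod (w t)" for n
      by (intro AE_I2 dom fn fB)
  qed
qed

text \<open>The Fourier transform turns the convolution into a product.\<close>

lemma B_alg_mult_fourier_L1:
  assumes "G \<in> B_alg" "integrable lborel w"
  shows "(\<lambda>\<xi>. G \<xi> * (LINT t|lborel. w t * character \<xi> t)) \<in> B_alg"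
proof -
  obtain \<mu> where \<mu>: "\<mu> \<in> complex_borel_measures" and G: "G = (\<lambda>\<xi>. complex_integral \<mu> (character \<xi>))"
    using B_algE[OF assms(1)] by metis
  have "(LINT t|lborel. w t * complex_integral \<mu> (\<lambda>x. character \<xi> (x + t)))
      = G \<xi> * (LINT t|lborel. w t * character \<xi> t)" for \<xi>
  proof -
    have "complex_integral \<mu> (\<lambda>x. character \<xi> (x + t)) = character \<xi> t * G \<xi>" for t
      using measure_functional_scale[OF measure_functional_complex_integral[OF \<mu>] character_bounded_borel]
      by (simp add: character_add G mult.commute[of "character \<xi> _" "character \<xi> t"])
    hence "(LINT t|lborel. w t * complex_integral \<mu> (\<lambda>x. character \<xi> (x + t)))
        = (LINT t|lborel. G \<xi> * (w t * character \<xi> t))"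
      by (simp add: mult_ac)
    thus ?thesis by simp
  qed
  thus ?thesis
    using B_alg_of_functional[OF measure_functional_convolution[OF \<mu> assms(2)]] by simp
qed


section \<open>Localization in the Fourier--Stieltjes algebra\<close>

definition cos_kernel_mass :: real where
  "cos_kernel_mass = (LINT x|lborel. (1 - cos x) / x\<^sup>2)"

text \<open>Near \<open>0\<close> the kernel is bounded because \<open>1 - cos x \<le> x\<^sup>2/2\<close>, and far out it is at most \<open>2/x\<^sup>2\<close>; a multiple of
\<open>1/(1 + x\<^sup>2)\<close> dominates both.\<close>

lemma cos_kernel_integrable: "integrable lborel (\<lambda>x::real. (1 - cos x) / x\<^sup>2)"
proof (rule Bochner_Integration.integrable_bound)
  show "integrable lborel (\<lambda>x::real. 4 * inverse (1 + x\<^sup>2))"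
    using integrable_inverse_1_plus_square by (simp add: set_integrable_def einterval_eq)
  show "AE x::real in lborel. norm ((1 - cos x) / x\<^sup>2) \<le> norm (4 * inverse (1 + x\<^sup>2))"
  proof (rule AE_I2)
    fix x :: real
    have "\<bar>sin (x / 2)\<bar> \<le> \<bar>x / 2\<bar>" by (rule abs_sin_x_le_abs_x)
    hence "(sin (x / 2))\<^sup>2 \<le> (x / 2)\<^sup>2" by (simp only: abs_le_square_iff)
    moreover have "1 - cos x = 2 * (sin (x / 2))\<^sup>2"
      using cos_double_sin[of "x / 2"] by simp
    ultimately have small: "1 - cos x \<le> x\<^sup>2 / 2" by (simp add: power_divide)
    have pos: "0 \<le> 1 - cos x" and large: "(1 - cos x) * x\<^sup>2 \<le> 2 * x\<^sup>2"
      using cos_ge_minus_one[of x] by (auto intro!: mult_right_mono)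
    have "(1 - cos x) * (1 + x\<^sup>2) \<le> 4 * x\<^sup>2"
      unfolding distrib_left mult_1_right using small large zero_le_power2[of x] by linarith
    moreover have "0 < 1 + x\<^sup>2" by (simp add: add_pos_nonneg)
    ultimately have "(1 - cos x) / x\<^sup>2 \<le> 4 * inverse (1 + x\<^sup>2)"
      by (cases "x = 0") (simp_all add: field_simps)
    thus "norm ((1 - cos x) / x\<^sup>2) \<le> norm (4 * inverse (1 + x\<^sup>2))"
      using pos \<open>0 < 1 + x\<^sup>2\<close> by (simp add: abs_of_nonneg)
  qed
qed simp

lemma cos_kernel_mass_pos: "0 < cos_kernel_mass"
proof -
  have nn: "0 \<le> (1 - cos x) / x\<^sup>2" for x :: real by simp
  have "cos_kernel_mass \<noteq> 0"
  proof
    assume "cos_kernel_mass = 0"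
    hence "AE x::real in lborel. (1 - cos x) / x\<^sup>2 = 0"
      unfolding cos_kernel_mass_def
      by (simp only: integral_nonneg_eq_0_iff_AE[OF cos_kernel_integrable AE_I2[OF nn]])
    moreover have "(1 - cos x) / x\<^sup>2 \<noteq> 0" if "x \<in> {0<..<pi}" for x :: real
      using that cos_monotone_0_pi[of 0 x] by auto
    ultimately have "AE x::real in lborel. x \<notin> {0<..<pi}"
      by (elim eventually_mono) blast
    hence "emeasure lborel {0<..<pi} = 0"
      by (subst (asm) AE_iff_measurable[of "{0<..<pi}"]) auto
    thus False by simp
  qed
  moreover have "0 \<le> cos_kernel_mass"
    unfolding cos_kernel_mass_def using nn by (intro integral_nonneg_AE) auto
  ultimately show ?thesis by simp
qed

text \<open>The substitution \<open>x \<mapsto> ax\<close> shows that the integral is proportional to \<open>|a|\<close>. The constant is divided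
out later, for which it has to be nonzero.\<close>

lemma abs_as_cos_integral:
  fixes a :: real
  shows "has_bochner_integral lborel (\<lambda>x. (1 - cos (a * x)) / x\<^sup>2) (\<bar>a\<bar> * cos_kernel_mass)"
proof (cases "a = 0")
  case False
  let ?k = "\<lambda>x::real. (1 - cos x) / x\<^sup>2"
  have eq: "(1 - cos (a * x)) / x\<^sup>2 = a\<^sup>2 * ?k (0 + a * x)" for x
    using False by (cases "x = 0") (simp_all add: field_simps)
  have int: "integrable lborel (\<lambda>x. ?k (0 + a * x))"
    using False by (intro lborel_integrable_real_affine[OF cos_kernel_integrable])
  have mass: "cos_kernel_mass = \<bar>a\<bar> *\<^sub>R (LINT x|lborel. ?k (0 + a * x))"
    unfolding cos_kernel_mass_def using False by (rule lborel_integral_real_affine)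
  have "a\<^sup>2 = \<bar>a\<bar> * \<bar>a\<bar>" by (simp add: power2_eq_square)
  hence "a\<^sup>2 * (LINT x|lborel. ?k (0 + a * x)) = \<bar>a\<bar> * cos_kernel_mass"
    by (simp only: mass real_scaleR_def mult.assoc)
  thus ?thesis
    unfolding eq using int by (simp only: has_bochner_integral_iff integral_mult_right_zero integrable_mult_right simp_thms)
qed (simp add: has_bochner_integral_zero)

text \<open>The function \<open>|\<xi> + 2h| + |\<xi> - 2h| - |\<xi> + h| - |\<xi> - h|\<close> is a trapezoid: it equals \<open>2h\<close> for \<open>|\<xi>| \<le> h\<close> and
vanishes for \<open>|\<xi>| \<ge> 2h\<close>. Writing each absolute value as a cosine integral and applying the addition theorem
gives \<open>\<integral> cos (\<xi>t) v(t) dt\<close> for an integrable even \<open>v\<close>, and evenness turns the cosine into a character.\<close>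

lemma trapezoid_fourier_transform:
  assumes h: "0 < h"
  obtains w where "integrable lborel w"
    and "\<And>\<xi>. \<bar>\<xi>\<bar> \<le> h \<Longrightarrow> (LINT t|lborel. w t * character \<xi> t) = 1"
    and "\<And>\<xi>. 2 * h \<le> \<bar>\<xi>\<bar> \<Longrightarrow> (LINT t|lborel. w t * character \<xi> t) = 0"
proof -
  let ?c = cos_kernel_mass
  define v where "v t = (2 * cos (h * t) - 2 * cos (2 * h * t)) / t\<^sup>2 / (2 * h * ?c)" for t
  let ?C = "\<lambda>a t. (1 - cos (a * t)) / t\<^sup>2"
  have v: "v t = (2 * ?C (2 * h) t - 2 * ?C h t) / (2 * h * ?c)" for t
    by (simp add: v_def diff_divide_distrib)
  have C: "integrable lborel (?C a)" "(LINT t|lborel. ?C a t) = \<bar>a\<bar> * ?c" for a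
    using abs_as_cos_integral[of a] by (auto simp: has_bochner_integral_iff)
  have v_int: "integrable lborel v" unfolding v
    by (intro integrable_divide Bochner_Integration.integrable_diff integrable_mult_right C(1))
  have w_int: "integrable lborel (\<lambda>t. complex_of_real (v t))" using v_int by simp
  have prod: "v t * cos (\<xi> * t)
      = (?C (\<xi> + 2 * h) t + ?C (\<xi> - 2 * h) t - ?C (\<xi> + h) t - ?C (\<xi> - h) t) / (2 * h * ?c)" for \<xi> t
  proof -
    have "(2 * cos (h * t) - 2 * cos (2 * h * t)) * cos (\<xi> * t)
      = (1 - cos ((\<xi> + 2 * h) * t)) + (1 - cos ((\<xi> - 2 * h) * t))
        - (1 - cos ((\<xi> + h) * t)) - (1 - cos ((\<xi> - h) * t))"
      by (simp add: distrib_right left_diff_distrib cos_add cos_diff)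
    note numerator = this
    have "v t * cos (\<xi> * t)
      = (2 * cos (h * t) - 2 * cos (2 * h * t)) * cos (\<xi> * t) / t\<^sup>2 / (2 * h * ?c)"
      by (simp add: v_def)
    also have "(2 * cos (h * t) - 2 * cos (2 * h * t)) * cos (\<xi> * t) / t\<^sup>2
      = ?C (\<xi> + 2 * h) t + ?C (\<xi> - 2 * h) t - ?C (\<xi> + h) t - ?C (\<xi> - h) t"
      unfolding numerator by (simp only: add_divide_distrib diff_divide_distrib)
    finally show ?thesis .
  qed
  have cos_int: "(LINT t|lborel. v t * cos (\<xi> * t))
      = (\<bar>\<xi> + 2 * h\<bar> + \<bar>\<xi> - 2 * h\<bar> - \<bar>\<xi> + h\<bar> - \<bar>\<xi> - h\<bar>) / (2 * h)" for \<xi>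
  proof -
    have "(LINT t|lborel. v t * cos (\<xi> * t))
      = (\<bar>\<xi> + 2 * h\<bar> * ?c + \<bar>\<xi> - 2 * h\<bar> * ?c - \<bar>\<xi> + h\<bar> * ?c - \<bar>\<xi> - h\<bar> * ?c) / (2 * h * ?c)"
      unfolding prod
      by (simp only: integral_divide_zero C Bochner_Integration.integral_add Bochner_Integration.integral_diff
        Bochner_Integration.integrable_add Bochner_Integration.integrable_diff)
    thus ?thesis
      using cos_kernel_mass_pos by (simp only: distrib_right[symmetric] left_diff_distrib[symmetric]) simp
  qed
  have ft: "(LINT t|lborel. complex_of_real (v t) * character \<xi> t)
      = complex_of_real ((\<bar>\<xi> + 2 * h\<bar> + \<bar>\<xi> - 2 * h\<bar> - \<bar>\<xi> + h\<bar> - \<bar>\<xi> - h\<bar>) / (2 * h))" for \<xi>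
  proof -
    let ?g = "\<lambda>t. complex_of_real (v t) * character \<xi> t"
    have g_int: "integrable lborel ?g"
    proof (rule Bochner_Integration.integrable_bound[OF w_int])
      show "?g \<in> borel_measurable lborel"
        using borel_measurable_integrable[OF w_int]
          borel_measurable_continuous_onI[OF continuous_on_character] by simp
    qed (simp add: norm_mult)
    \<comment> \<open>Averaging over the reflection leaves only the cosine.\<close>
    have "(LINT t|lborel. ?g t) = (LINT t|lborel. ?g (- t))"
      using lborel_integral_real_affine[of "- 1" ?g 0] by simp
    moreover have g_int': "integrable lborel (\<lambda>t. ?g (- t))"
      using lborel_integrable_real_affine[OF g_int, of "- 1" 0] by simp
    ultimately have "2 * (LINT t|lborel. ?g t) = (LINT t|lborel. ?g t + ?g (- t))"
      using g_int by simp
    also have "\<dots> = (LINT t|lborel. complex_of_real (2 * (v t * cos (\<xi> * t))))"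
    proof (rule Bochner_Integration.integral_cong)
      fix t
      have "v (- t) = v t" by (simp add: v_def)
      thus "?g t + ?g (- t) = complex_of_real (2 * (v t * cos (\<xi> * t)))"
        by (simp add: character_cis complex_eq_iff)
    qed simp
    also have "\<dots> = complex_of_real (LINT t|lborel. 2 * (v t * cos (\<xi> * t)))"
      by (rule integral_complex_of_real)
    also have "\<dots> = 2 * complex_of_real (LINT t|lborel. v t * cos (\<xi> * t))" by simp
    finally show ?thesis unfolding cos_int[symmetric] by simp
  qed
  show thesis
  proof (rule that[OF w_int])
    fix \<xi> :: real assume "\<bar>\<xi>\<bar> \<le> h"
    hence "\<bar>\<xi> + 2 * h\<bar> + \<bar>\<xi> - 2 * h\<bar> - \<bar>\<xi> + h\<bar> - \<bar>\<xi> - h\<bar> = 2 * h" using h by auto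
    thus "(LINT t|lborel. complex_of_real (v t) * character \<xi> t) = 1" unfolding ft using h by simp
  next
    fix \<xi> :: real assume "2 * h \<le> \<bar>\<xi>\<bar>"
    hence "\<bar>\<xi> + 2 * h\<bar> + \<bar>\<xi> - 2 * h\<bar> - \<bar>\<xi> + h\<bar> - \<bar>\<xi> - h\<bar> = 0" using h by auto
    thus "(LINT t|lborel. complex_of_real (v t) * character \<xi> t) = 0" unfolding ft by simp
  qed
qed

text \<open>The multiplier \<open>b\<close> is a translated trapezoid; translating the transform means multiplying the density
by a character.\<close>

lemma B_alg_localize:
  assumes "0 < h"
  obtains b where "\<And>G. G \<in> B_alg \<Longrightarrow> (\<lambda>\<xi>. G \<xi> * b \<xi>) \<in> B_alg"
    and "\<And>\<xi>. \<bar>\<xi> - x\<bar> \<le> h \<Longrightarrow> b \<xi> = 1" and "\<And>\<xi>. 2 * h \<le> \<bar>\<xi> - x\<bar> \<Longrightarrow> b \<xi> = (0 :: complex)"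
proof -
  obtain w where w: "integrable lborel w"
    "\<And>\<xi>. \<bar>\<xi>\<bar> \<le> h \<Longrightarrow> (LINT t|lborel. w t * character \<xi> t) = 1"
    "\<And>\<xi>. 2 * h \<le> \<bar>\<xi>\<bar> \<Longrightarrow> (LINT t|lborel. w t * character \<xi> t) = 0"
    using trapezoid_fourier_transform[OF assms] by metis
  have "integrable lborel (\<lambda>t. w t * character (- x) t)"
  proof (rule Bochner_Integration.integrable_bound[OF w(1)])
    show "(\<lambda>t. w t * character (- x) t) \<in> borel_measurable lborel"
      using borel_measurable_integrable[OF w(1)]
        borel_measurable_continuous_onI[OF continuous_on_character] by simp
  qed (simp add: norm_mult)
  moreover have "w t * character (- x) t * character \<xi> t = w t * character (\<xi> - x) t" for t \<xi>
    by (simp add: character_def exp_add[symmetric] algebra_simps)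
  ultimately have "(\<lambda>\<xi>. G \<xi> * (LINT t|lborel. w t * character (\<xi> - x) t)) \<in> B_alg" if "G \<in> B_alg" for G
    using B_alg_mult_fourier_L1[OF that, of "\<lambda>t. w t * character (- x) t"] by (simp only:)
  thus thesis using w(2,3) by (intro that[of "\<lambda>\<xi>. LINT t|lborel. w t * character (\<xi> - x) t"]) auto
qed

text \<open>To add a point \<open>x\<close> to the set, interpolate: \<open>G + (H - G) b\<close> equals \<open>H\<close> near \<open>x\<close> and \<open>G\<close> away from \<open>x\<close>, if \<open>b\<close> is a
trapezoid around \<open>x\<close> that is narrow compared with the distance from \<open>x\<close> to the other points.\<close>

lemma B_loc_near_finite_set:
  assumes F: "F \<in> B_loc" and "finite S"
  shows "\<exists>U. open U \<and> S \<subseteq> U \<and> (\<exists>G\<in>B_alg. \<forall>\<xi>\<in>U. F \<xi> = G \<xi>)"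
  using \<open>finite S\<close>
proof (induction S rule: finite_induct)
  case empty
  obtain G where "G \<in> B_alg" using F unfolding B_loc_def by blast
  thus ?case by (intro exI[of _ "{}"]) auto
next
  case (insert x S)
  obtain U G where U: "open U" "S \<subseteq> U" "G \<in> B_alg" "\<And>\<xi>. \<xi> \<in> U \<Longrightarrow> F \<xi> = G \<xi>"
    using insert.IH by blast
  obtain V H where V: "open V" "x \<in> V" "H \<in> B_alg" "\<And>\<xi>. \<xi> \<in> V \<Longrightarrow> F \<xi> = H \<xi>"
    using F unfolding B_loc_def by blast
  have "open (- S)" using insert.hyps(1) by (simp add: finite_imp_closed open_Compl)
  then obtain d where d: "0 < d" "ball x d \<subseteq> - S"
    using insert.hyps(2) by (meson Compl_iff openE)
  define h where "h = d / 4"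
  have h: "0 < h" using d(1) by (simp add: h_def)
  obtain b where b: "\<And>G. G \<in> B_alg \<Longrightarrow> (\<lambda>\<xi>. G \<xi> * b \<xi>) \<in> B_alg"
    "\<And>\<xi>. \<bar>\<xi> - x\<bar> \<le> h \<Longrightarrow> b \<xi> = 1" "\<And>\<xi>. 2 * h \<le> \<bar>\<xi> - x\<bar> \<Longrightarrow> b \<xi> = (0 :: complex)"
    using B_alg_localize[OF h, of x] by metis
  \<comment> \<open>The trapezoid \<open>b\<close> vanishes outside the ball of radius \<open>2h\<close>, half the distance \<open>d\<close>, so \<open>K = G\<close> near \<open>S\<close>.\<close>
  define K where "K \<xi> = 1 * G \<xi> + 1 * ((1 * H \<xi> + (-1) * G \<xi>) * b \<xi>)" for \<xi>
  have "K \<in> B_alg"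
    unfolding K_def by (intro B_alg_combine b(1) U(3) V(3))
  moreover have "open ((U - cball x (2 * h)) \<union> (V \<inter> ball x h))"
    using U(1) V(1) by (intro open_Un open_Diff open_Int) auto
  moreover have "insert x S \<subseteq> (U - cball x (2 * h)) \<union> (V \<inter> ball x h)"
  proof -
    have "y \<notin> cball x (2 * h)" if "y \<in> S" for y
      using d that h by (force simp: h_def subset_eq)
    thus ?thesis using U(2) V(2) h by auto
  qed
  moreover have "F \<xi> = K \<xi>" if "\<xi> \<in> (U - cball x (2 * h)) \<union> (V \<inter> ball x h)" for \<xi>
    using that
  proof
    assume *: "\<xi> \<in> U - cball x (2 * h)"
    hence "b \<xi> = 0" by (intro b(3)) (auto simp: dist_real_def)
    thus ?thesis using U(4)[of \<xi>] * by (simp add: K_def)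
  next
    assume *: "\<xi> \<in> V \<inter> ball x h"
    hence "b \<xi> = 1" by (intro b(2)) (auto simp: dist_real_def)
    thus ?thesis using V(4)[of \<xi>] * by (simp add: K_def)
  qed
  ultimately show ?case by blast
qed

lemma B_loc_continuous:
  assumes "F \<in> B_loc"
  shows "continuous_on UNIV F"
proof -
  have "isCont F x" for x
  proof -
    obtain U G where U: "open U" "x \<in> U" "G \<in> B_alg" "\<And>\<xi>. \<xi> \<in> U \<Longrightarrow> F \<xi> = G \<xi>"
      using assms unfolding B_loc_def by blast
    have "eventually (\<lambda>\<xi>. F \<xi> = G \<xi>) (nhds x)"
      using U(1,2,4) by (auto simp: eventually_nhds)
    moreover have "isCont G x"
      using B_alg_continuous[OF U(3)] by (simp add: continuous_on_eq_continuous_at)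
    ultimately show ?thesis by (simp add: isCont_cong)
  qed
  thus ?thesis by (simp add: continuous_at_imp_continuous_on)
qed


section \<open>The extremal norm on functions on three nodes\<close>

text \<open>The algebra consists of functions on these three points. They serve as the frequencies of
trigonometric polynomials, and \<open>k\<close> stands for the point \<open>y + hk\<close> of the real line.\<close>

definition nodes :: "real set" where
  "nodes = {-1, 0, 1}"

lemma sum_nodes: "(\<Sum>k\<in>nodes. f k) = f (-1) + f 0 + f 1"
  by (simp add: nodes_def add.assoc)

lemma finite_nodes [simp]: "finite nodes" by (simp add: nodes_def)

lemma zero_in_nodes: "0 \<in> nodes" by (simp add: nodes_def)

definition trig :: "(real \<Rightarrow> complex) \<Rightarrow> real \<Rightarrow> complex" where
  "trig c t = (\<Sum>k\<in>nodes. c k * character k t)"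

definition trig_ball :: "(real \<Rightarrow> complex) set" where
  "trig_ball = {c. \<forall>t. cmod (trig c t) \<le> 1}"

text \<open>The norm dual to the sup norm of trigonometric polynomials: the largest algebra norm in which
\<open>(e\<^sup>i\<^sup>k\<^sup>t)\<^sub>k\<close> has norm at most \<open>1\<close> for all \<open>t\<close>.\<close>

definition node_norm :: "(real \<Rightarrow> complex) \<Rightarrow> real" where
  "node_norm g = (SUP c\<in>trig_ball. cmod (\<Sum>k\<in>nodes. c k * g k))"

text \<open>The coefficients are recovered from the values at \<open>0\<close>, \<open>\<pi>\<close> and \<open>\<plusminus>\<pi>/2\<close>.\<close>

lemma trig_ball_coefficient:
  assumes "c \<in> trig_ball" "k \<in> nodes"
  shows "cmod (c k) \<le> 1"
proof -
  have le: "cmod (trig c t) \<le> 1" for t using assms(1) by (simp add: trig_ball_def)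
  have val: "trig c t = c (-1) * cis (- t) + c 0 + c 1 * cis t" for t
    by (simp add: trig_def sum_nodes character_cis)
  have half: "cmod ((z + w) / 2) \<le> 1" if "cmod z \<le> 1" "cmod w \<le> 1" for z w :: complex
    using norm_triangle_ineq[of z w] that by (simp add: norm_divide)
  have sum: "c (-1) + c 1 = (trig c 0 + - trig c pi) / 2" and zero: "c 0 = (trig c 0 + trig c pi) / 2"
    by (simp_all add: val cis.code complex_eq_iff field_simps)
  have diff: "\<i> * (c 1 - c (-1)) = (trig c (pi / 2) + - trig c (- (pi / 2))) / 2"
    by (simp add: val cis.code complex_eq_iff)
  have "cmod (c 0) \<le> 1" unfolding zero by (intro half le)
  moreover have s: "cmod (c (-1) + c 1) \<le> 1" unfolding sum using le by (intro half) simp_all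
  moreover have d: "cmod (c 1 - c (-1)) \<le> 1"
  proof -
    have "cmod (\<i> * (c 1 - c (-1))) \<le> 1" unfolding diff using le by (intro half) simp_all
    thus ?thesis by (simp add: norm_mult)
  qed
  moreover have "cmod (c 1) \<le> 1"
    using half[OF s d] by simp
  moreover have "cmod (c (-1)) \<le> 1"
    using half[of "c (-1) + c 1" "c (-1) - c 1"] s d by (simp add: norm_minus_commute)
  ultimately show ?thesis using assms(2) by (auto simp: nodes_def)
qed

lemma node_pairing_le_sum:
  assumes "c \<in> trig_ball"
  shows "cmod (\<Sum>k\<in>nodes. c k * g k) \<le> (\<Sum>k\<in>nodes. cmod (g k))"
proof -
  have "cmod (\<Sum>k\<in>nodes. c k * g k) \<le> (\<Sum>k\<in>nodes. cmod (c k * g k))" by (rule norm_sum)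
  also have "\<dots> \<le> (\<Sum>k\<in>nodes. cmod (g k))"
    using trig_ball_coefficient[OF assms]
    by (intro sum_mono) (simp add: norm_mult mult_left_le_one_le)
  finally show ?thesis .
qed

lemma node_norm_upper:
  assumes "c \<in> trig_ball"
  shows "cmod (\<Sum>k\<in>nodes. c k * g k) \<le> node_norm g"
  unfolding node_norm_def using assms node_pairing_le_sum
  by (intro cSUP_upper bdd_aboveI2[where M = "\<Sum>k\<in>nodes. cmod (g k)"])

lemma zero_in_trig_ball: "(\<lambda>_. 0) \<in> trig_ball"
  by (simp add: trig_ball_def trig_def)

lemma node_norm_least:
  assumes "\<And>c. c \<in> trig_ball \<Longrightarrow> cmod (\<Sum>k\<in>nodes. c k * g k) \<le> B"
  shows "node_norm g \<le> B"
  unfolding node_norm_def using assms zero_in_trig_ball by (intro cSUP_least) auto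

lemma node_norm_nonneg: "0 \<le> node_norm g"
  using node_norm_upper[OF zero_in_trig_ball] by simp

lemma node_norm_le_sum: "node_norm g \<le> (\<Sum>k\<in>nodes. cmod (g k))"
  by (intro node_norm_least node_pairing_le_sum)

definition node_basis :: "real \<Rightarrow> real \<Rightarrow> complex" where
  "node_basis k r = (if r = k then 1 else 0)"

lemma sum_node_basis: "k \<in> nodes \<Longrightarrow> (\<Sum>j\<in>nodes. node_basis k j * g j) = g k"
  by (subst sum.remove[of nodes k]) (auto simp: node_basis_def intro!: sum.neutral)

lemma cmod_le_node_norm:
  assumes "k \<in> nodes"
  shows "cmod (g k) \<le> node_norm g"
proof -
  have "node_basis k \<in> trig_ball"
    by (simp add: trig_ball_def trig_def sum_node_basis[OF assms])
  from node_norm_upper[OF this, of g] show ?thesis by (simp add: sum_node_basis[OF assms])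
qed

lemma node_norm_cong: "(\<And>k. k \<in> nodes \<Longrightarrow> f k = g k) \<Longrightarrow> node_norm f = node_norm g"
  unfolding node_norm_def by (intro SUP_cong arg_cong[where f = cmod] sum.cong) auto

lemma node_norm_eq_0_iff: "node_norm g = 0 \<longleftrightarrow> (\<forall>k\<in>nodes. g k = 0)"
proof
  assume "node_norm g = 0"
  thus "\<forall>k\<in>nodes. g k = 0" using cmod_le_node_norm[of _ g] by auto
next
  assume "\<forall>k\<in>nodes. g k = 0"
  hence "node_norm g \<le> 0" using node_norm_le_sum[of g] by simp
  thus "node_norm g = 0" using node_norm_nonneg[of g] by simp
qed

lemma node_norm_triangle: "node_norm (\<lambda>r. f r + g r) \<le> node_norm f + node_norm g"
proof (rule node_norm_least)
  fix c assume c: "c \<in> trig_ball"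
  have "(\<Sum>k\<in>nodes. c k * (f k + g k)) = (\<Sum>k\<in>nodes. c k * f k) + (\<Sum>k\<in>nodes. c k * g k)"
    by (simp add: distrib_left sum.distrib)
  thus "cmod (\<Sum>k\<in>nodes. c k * (f k + g k)) \<le> node_norm f + node_norm g"
    using norm_triangle_mono[OF node_norm_upper[OF c, of f] node_norm_upper[OF c, of g]] by simp
qed

lemma node_norm_scale: "node_norm (\<lambda>r. z * g r) = cmod z * node_norm g"
proof -
  have le: "node_norm (\<lambda>r. z * g r) \<le> cmod z * node_norm g" for z g
  proof (rule node_norm_least)
    fix c assume c: "c \<in> trig_ball"
    have "(\<Sum>k\<in>nodes. c k * (z * g k)) = z * (\<Sum>k\<in>nodes. c k * g k)"
      by (simp add: sum_distrib_left mult.left_commute)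
    thus "cmod (\<Sum>k\<in>nodes. c k * (z * g k)) \<le> cmod z * node_norm g"
      using node_norm_upper[OF c, of g] by (simp add: norm_mult mult_left_mono)
  qed
  show ?thesis
  proof (cases "z = 0")
    case True
    thus ?thesis by (simp add: node_norm_eq_0_iff)
  next
    case False
    have "node_norm g \<le> cmod (inverse z) * node_norm (\<lambda>r. z * g r)"
      using le[of "inverse z" "\<lambda>r. z * g r"] False by (simp add: mult.assoc[symmetric])
    hence "cmod z * node_norm g \<le> node_norm (\<lambda>r. z * g r)"
      using False by (simp add: norm_divide field_simps)
    thus ?thesis using le[of z g] by simp
  qed
qed

lemma node_pairing_bound:
  assumes "0 < M" "\<And>t. cmod (trig c t) \<le> M"
  shows "cmod (\<Sum>k\<in>nodes. c k * g k) \<le> M * node_norm g"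
proof -
  have sc: "(\<Sum>k\<in>nodes. c k / of_real M * f k) = (\<Sum>k\<in>nodes. c k * f k) / of_real M" for f
    by (simp add: sum_divide_distrib)
  have "trig (\<lambda>k. c k / of_real M) t = trig c t / of_real M" for t
    unfolding trig_def by (rule sc)
  hence "(\<lambda>k. c k / of_real M) \<in> trig_ball"
    using assms by (simp add: trig_ball_def norm_divide)
  from node_norm_upper[OF this, of g] show ?thesis
    using assms(1) unfolding sc by (simp add: norm_divide field_simps)
qed

text \<open>If \<open>c\<close> lies in the ball, so do its translates \<open>c\<^sub>k e\<^sup>i\<^sup>k\<^sup>t\<close>. Hence the polynomial with
coefficients \<open>c\<^sub>k f(k)\<close>, whose value at \<open>t\<close> is the pairing of such a translate with \<open>f\<close>, is bounded by the norm of \<open>f\<close>.\<close>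

lemma node_norm_mult: "node_norm (\<lambda>r. f r * g r) \<le> node_norm f * node_norm g"
proof (cases "node_norm f = 0")
  case True
  hence "node_norm (\<lambda>r. f r * g r) = 0" by (simp add: node_norm_eq_0_iff)
  thus ?thesis using True by simp
next
  case False
  hence pos: "0 < node_norm f" using node_norm_nonneg[of f] by simp
  show ?thesis
  proof (rule node_norm_least)
    fix c assume c: "c \<in> trig_ball"
    have "cmod (trig (\<lambda>k. c k * f k) t) \<le> node_norm f" for t
    proof -
      have "(\<lambda>k. c k * character k t) \<in> trig_ball"
        using c by (simp add: trig_ball_def trig_def character_add[symmetric] mult.assoc)
      from node_norm_upper[OF this, of f] show ?thesis by (simp add: trig_def mult_ac)
    qed
    from node_pairing_bound[OF pos this, of g]
    show "cmod (\<Sum>k\<in>nodes. c k * (f k * g k)) \<le> node_norm f * node_norm g"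
      by (simp add: mult.assoc)
  qed
qed

lemma node_norm_one: "node_norm (\<lambda>_. 1) = 1"
proof (rule antisym)
  show "node_norm (\<lambda>_. 1) \<le> 1"
  proof (rule node_norm_least)
    fix c assume "c \<in> trig_ball"
    hence "cmod (trig c 0) \<le> 1" by (simp add: trig_ball_def)
    thus "cmod (\<Sum>k\<in>nodes. c k * 1) \<le> 1" by (simp add: trig_def character_cis)
  qed
  show "1 \<le> node_norm (\<lambda>_. 1)"
    using cmod_le_node_norm[OF zero_in_nodes, of "\<lambda>_. 1"] by simp
qed

lemma node_norm_character: "node_norm (\<lambda>k. character k t) \<le> 1"
  by (rule node_norm_least) (simp add: trig_ball_def trig_def)

text \<open>With \<open>v = u / z\<close> the expression is \<open>1 + s(v - v')\<close>, where \<open>v'\<close> is the conjugate of \<open>v\<close>. The difference is purely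
imaginary, so it contributes only to second order.\<close>

lemma three_point_functional_bound:
  assumes "cmod u = 1" "cmod z = 1"
  shows "cmod (of_real s * u * cnj z + 1 - of_real s * cnj u * z) \<le> sqrt (1 + 4 * s\<^sup>2)"
proof -
  define v where "v = u * cnj z"
  have "of_real s * u * cnj z + 1 - of_real s * cnj u * z = 1 + of_real s * (v - cnj v)"
    by (simp add: v_def algebra_simps)
  also have "\<dots> = Complex 1 (2 * s * Im v)"
    by (simp add: complex_eq_iff)
  finally have "cmod (of_real s * u * cnj z + 1 - of_real s * cnj u * z) = sqrt (1 + (2 * s * Im v)\<^sup>2)"
    by (simp add: cmod_def)
  moreover have "\<bar>Im v\<bar> \<le> 1" using abs_Im_le_cmod[of v] assms by (simp add: v_def norm_mult)
  hence "(Im v)\<^sup>2 \<le> 1" by (simp add: abs_square_le_1)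
  hence "(2 * s * Im v)\<^sup>2 \<le> 4 * s\<^sup>2"
    by (simp add: power_mult_distrib mult_left_le)
  ultimately show ?thesis by simp
qed

text \<open>Rotate so that \<open>B\<close> is nonnegative. The real part of the expression is then \<open>B + s Re (u W)\<close> with
\<open>W\<close> the difference of \<open>A\<close> and the conjugate of \<open>C\<close>; choose \<open>u\<close> so that \<open>u W = |W|\<close>.\<close>

lemma three_point_functional_value:
  fixes A B C :: complex
  assumes "0 \<le> s"
  obtains u where "cmod u = 1"
    and "cmod B + s * \<bar>cmod A - cmod C\<bar> \<le> cmod (of_real s * u * A + B - of_real s * cnj u * C)"
proof -
  obtain p where p: "cmod p = 1" "cnj p * B = of_real (cmod B)"
  proof (cases "B = 0")
    case False
    have "cnj (sgn B) * B = of_real (cmod B)"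
      using False by (simp add: sgn_eq complex_norm_square[symmetric] power2_eq_square mult.commute)
    thus ?thesis using that[of "sgn B"] False by (simp add: norm_sgn)
  qed (use that[of 1] in simp)
  define W where "W = cnj p * A - p * cnj C"
  obtain u where u: "cmod u = 1" "u * W = of_real (cmod W)"
  proof (cases "W = 0")
    case False
    have "cnj (sgn W) * W = of_real (cmod W)"
      using False by (simp add: sgn_eq complex_norm_square[symmetric] power2_eq_square mult.commute)
    thus ?thesis using that[of "cnj (sgn W)"] False by (simp add: norm_sgn)
  qed (use that[of 1] in simp)
  have W: "\<bar>cmod A - cmod C\<bar> \<le> cmod W"
    using norm_triangle_ineq3[of "cnj p * A" "p * cnj C"] p(1) by (simp add: W_def norm_mult)
  have "cmod B + s * \<bar>cmod A - cmod C\<bar> \<le> cmod (of_real s * u * A + B - of_real s * cnj u * C)"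
  proof -
    let ?v = "of_real s * u * A + B - of_real s * cnj u * C"
    have "Re (cnj p * ?v) = Re (cnj p * B) + s * (Re (u * (cnj p * A)) - Re (cnj (u * (p * cnj C))))"
      by (simp add: algebra_simps)
    also have "Re (cnj (u * (p * cnj C))) = Re (u * (p * cnj C))" by (rule cnj.sel)
    also have "Re (u * (cnj p * A)) - Re (u * (p * cnj C)) = Re (u * W)"
      by (simp add: W_def right_diff_distrib)
    finally have "Re (cnj p * ?v) = cmod B + s * cmod W" using p(2) u(2) by simp
    moreover have "Re (cnj p * ?v) \<le> cmod ?v"
      using complex_Re_le_cmod[of "cnj p * ?v"] p(1) by (simp add: norm_mult)
    moreover have "s * \<bar>cmod A - cmod C\<bar> \<le> s * cmod W" using W assms by (rule mult_left_mono)
    ultimately show ?thesis by simp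
  qed
  thus thesis using that u(1) by blast
qed

lemma node_norm_three_point:
  assumes "0 \<le> s"
  shows "cmod (g 0) + s * \<bar>cmod (g (-1)) - cmod (g 1)\<bar> \<le> sqrt (1 + 4 * s\<^sup>2) * node_norm g"
proof -
  obtain u where u: "cmod u = 1" "cmod (g 0) + s * \<bar>cmod (g (-1)) - cmod (g 1)\<bar>
      \<le> cmod (of_real s * u * g (-1) + g 0 - of_real s * cnj u * g 1)"
    using three_point_functional_value[OF assms, of "g 0" "g (-1)" "g 1"] by metis
  define c where "c k = (if k = -1 then of_real s * u else if k = 0 then 1 else - of_real s * cnj u)" for k :: real
  have pair: "(\<Sum>k\<in>nodes. c k * f k) = of_real s * u * f (-1) + f 0 - of_real s * cnj u * f 1" for f
    by (simp add: sum_nodes c_def)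
  have "cmod (trig c t) \<le> sqrt (1 + 4 * s\<^sup>2)" for t
    using three_point_functional_bound[OF u(1), of "cis t" s]
    by (simp add: trig_def pair character_cis cis_cnj)
  hence "cmod (\<Sum>k\<in>nodes. c k * g k) \<le> sqrt (1 + 4 * s\<^sup>2) * node_norm g"
    by (intro node_pairing_bound) (auto intro: add_pos_nonneg)
  thus ?thesis using u(2) unfolding pair by simp
qed


section \<open>The three-dimensional Banach algebra of the nodes\<close>

text \<open>Extension by zero. Its range serves as the carrier, so that elements are determined by their values on the nodes.\<close>

definition on_nodes :: "(real \<Rightarrow> complex) \<Rightarrow> real \<Rightarrow> complex" where
  "on_nodes g r = (if r \<in> nodes then g r else 0)"

definition node_algebra :: "(real \<Rightarrow> complex) normed_alg" where
  "node_algebra = \<lparr>carrier = range on_nodes, monoid.mult = (\<lambda>f g r. f r * g r), one = on_nodes (\<lambda>_. 1),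
     ring.zero = (\<lambda>_. 0), add = (\<lambda>f g r. f r + g r), module.smult = (\<lambda>z g r. z * g r), alg_norm = node_norm\<rparr>"

lemma on_nodes_simps [simp]:
  "k \<in> nodes \<Longrightarrow> on_nodes g k = g k"
  "k \<notin> nodes \<Longrightarrow> on_nodes g k = 0"
  by (simp_all add: on_nodes_def)

lemma node_norm_on_nodes [simp]: "node_norm (on_nodes g) = node_norm g"
  by (rule node_norm_cong) simp

lemma in_range_on_nodes: "g \<in> range on_nodes \<longleftrightarrow> (\<forall>r. r \<notin> nodes \<longrightarrow> g r = 0)"
proof
  assume "\<forall>r. r \<notin> nodes \<longrightarrow> g r = 0"
  hence "g = on_nodes g" by (auto simp: on_nodes_def)
  thus "g \<in> range on_nodes" by blast
qed auto

lemma node_algebra_simps [simp]: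
  "carrier node_algebra = range on_nodes"
  "f \<otimes>\<^bsub>node_algebra\<^esub> g = (\<lambda>r. f r * g r)"
  "\<one>\<^bsub>node_algebra\<^esub> = on_nodes (\<lambda>_. 1)"
  "\<zero>\<^bsub>node_algebra\<^esub> = (\<lambda>_. 0)"
  "f \<oplus>\<^bsub>node_algebra\<^esub> g = (\<lambda>r. f r + g r)"
  "z \<odot>\<^bsub>node_algebra\<^esub> g = (\<lambda>r. z * g r)"
  "alg_norm node_algebra = node_norm"
  by (simp_all add: node_algebra_def)

lemma node_algebra_abelian_group: "abelian_group node_algebra"
proof (rule abelian_groupI)
  fix x assume x: "x \<in> carrier node_algebra"
  show "\<exists>y\<in>carrier node_algebra. y \<oplus>\<^bsub>node_algebra\<^esub> x = \<zero>\<^bsub>node_algebra\<^esub>"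
    using x by (intro bexI[of _ "\<lambda>r. - x r"]) (auto simp: in_range_on_nodes)
qed (auto simp: in_range_on_nodes add.assoc add.commute)

lemma node_algebra_ring: "ring node_algebra"
proof (rule ringI[OF node_algebra_abelian_group])
  show "monoid node_algebra"
    by (rule monoidI) (auto simp: in_range_on_nodes mult.assoc on_nodes_def fun_eq_iff)
qed (auto simp: distrib_left distrib_right)

interpretation node: ring node_algebra by (rule node_algebra_ring)

lemma node_minus:
  assumes "f \<in> range on_nodes" "g \<in> range on_nodes"
  shows "f \<ominus>\<^bsub>node_algebra\<^esub> g = (\<lambda>r. f r - g r)"
proof -
  have "(\<lambda>r. - g r) \<oplus>\<^bsub>node_algebra\<^esub> g = \<zero>\<^bsub>node_algebra\<^esub>" by simp
  hence "\<ominus>\<^bsub>node_algebra\<^esub> g = (\<lambda>r. - g r)"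
    using assms(2) by (intro node.minus_equality) (auto simp: in_range_on_nodes)
  thus ?thesis by (simp add: a_minus_def)
qed

lemma complex_ring_cring: "cring complex_ring"
proof (rule cringI)
  show "abelian_group complex_ring"
    by (rule abelian_groupI) (auto simp: complex_ring_def intro: exI[of _ "- x" for x :: complex])
  show "comm_monoid complex_ring"
    by (rule comm_monoidI) (auto simp: complex_ring_def)
qed (auto simp: complex_ring_def distrib_right)

lemma node_dist:
  assumes "f \<in> range on_nodes" "g \<in> range on_nodes"
  shows "alg_dist node_algebra f g = node_norm (\<lambda>r. f r - g r)"
  using assms by (simp add: alg_dist_def node_minus)

lemma node_Metric_space: "Metric_space (range on_nodes) (alg_dist node_algebra)"
proof
  fix f g :: "real \<Rightarrow> complex"
  show "0 \<le> alg_dist node_algebra f g" by (simp add: alg_dist_def node_norm_nonneg)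
  have "node_norm (\<lambda>r. f r - g r) = node_norm (\<lambda>r. g r - f r)"
    using node_norm_scale[of "-1" "\<lambda>r. f r - g r"] by simp
  thus "alg_dist node_algebra f g = alg_dist node_algebra g f"
    by (simp add: alg_dist_def node_minus)
next
  fix f g :: "real \<Rightarrow> complex"
  assume fg: "f \<in> range on_nodes" "g \<in> range on_nodes"
  thus "(alg_dist node_algebra f g = 0) = (f = g)"
    by (auto simp: node_dist node_norm_eq_0_iff in_range_on_nodes fun_eq_iff)
next
  fix f g h :: "real \<Rightarrow> complex"
  assume "f \<in> range on_nodes" "g \<in> range on_nodes" "h \<in> range on_nodes"
  thus "alg_dist node_algebra f h \<le> alg_dist node_algebra f g + alg_dist node_algebra g h"
    using node_norm_triangle[of "\<lambda>r. f r - g r" "\<lambda>r. g r - h r"] by (simp add: node_dist)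
qed

text \<open>The norm lies between the maximum and the sum of the moduli, so convergence is pointwise.\<close>

lemma node_limitin:
  assumes "\<And>n. f n \<in> range on_nodes" "l \<in> range on_nodes" "\<And>k. k \<in> nodes \<Longrightarrow> (\<lambda>n. f n k) \<longlonglongrightarrow> l k"
  shows "limitin (Metric_space.mtopology (range on_nodes) (alg_dist node_algebra)) f l sequentially"
proof -
  interpret Metric_space "range on_nodes" "alg_dist node_algebra" by (rule node_Metric_space)
  have "(\<lambda>n. node_norm (\<lambda>r. f n r - l r)) \<longlonglongrightarrow> 0"
  proof (rule tendsto_sandwich[OF _ _ tendsto_const])
    show "(\<lambda>n. \<Sum>k\<in>nodes. cmod (f n k - l k)) \<longlonglongrightarrow> 0"
      using assms(3) by (intro tendsto_null_sum tendsto_norm_zero) (simp add: LIM_zero_iff)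
  qed (auto intro!: always_eventually node_norm_nonneg node_norm_le_sum)
  thus ?thesis
    using assms by (simp add: limitin_metric_dist_null node_dist)
qed

lemma node_complete: "Metric_space.mcomplete (range on_nodes) (alg_dist node_algebra)"
proof -
  interpret Metric_space "range on_nodes" "alg_dist node_algebra" by (rule node_Metric_space)
  show ?thesis
    unfolding mcomplete_def
  proof (intro allI impI)
    fix f assume f: "MCauchy f"
    hence car: "f n \<in> range on_nodes" for n by (auto simp: MCauchy_def)
    have "convergent (\<lambda>n. f n k)" if k: "k \<in> nodes" for k
    proof -
      have "Cauchy (\<lambda>n. f n k)"
      proof (rule metric_CauchyI)
        fix e :: real assume "0 < e"
        then obtain N where N: "\<And>m n. N \<le> m \<Longrightarrow> N \<le> n \<Longrightarrow> alg_dist node_algebra (f m) (f n) < e"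
          using f unfolding MCauchy_def by meson
        show "\<exists>N. \<forall>m\<ge>N. \<forall>n\<ge>N. dist (f m k) (f n k) < e"
        proof (intro exI allI impI)
          fix m n assume "N \<le> m" "N \<le> n"
          hence "node_norm (\<lambda>r. f m r - f n r) < e" using N[of m n] car by (simp add: node_dist)
          thus "dist (f m k) (f n k) < e"
            using cmod_le_node_norm[OF k, of "\<lambda>r. f m r - f n r"] by (simp add: dist_norm)
        qed
      qed
      thus ?thesis by (simp add: Cauchy_convergent_iff)
    qed
    hence "limitin mtopology f (on_nodes (\<lambda>k. lim (\<lambda>n. f n k))) sequentially"
      using car by (intro node_limitin) (auto simp: convergent_LIMSEQ_iff)
    thus "\<exists>l. limitin mtopology f l sequentially" by - (rule exI)
  qed
qed

lemma node_complex_banach_algebra: "complex_banach_algebra node_algebra"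
proof (rule complex_banach_algebra.intro)
  show "ring node_algebra" by (rule node_algebra_ring)
  show "Module.module complex_ring node_algebra"
    by (rule moduleI[OF complex_ring_cring node_algebra_abelian_group])
      (auto simp: complex_ring_def in_range_on_nodes algebra_simps)
  show "Metric_space.mcomplete (carrier node_algebra) (alg_dist node_algebra)"
    using node_complete by simp
  show "alg_norm node_algebra \<one>\<^bsub>node_algebra\<^esub> = 1" by (simp add: node_norm_one)
  fix x y :: "real \<Rightarrow> complex" and c :: complex
  assume x: "x \<in> carrier node_algebra"
  show "0 \<le> alg_norm node_algebra x" by (simp add: node_norm_nonneg)
  show "alg_norm node_algebra x = 0 \<longleftrightarrow> x = \<zero>\<^bsub>node_algebra\<^esub>"
    using x by (auto simp: node_norm_eq_0_iff fun_eq_iff in_range_on_nodes)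
  show "alg_norm node_algebra (c \<odot>\<^bsub>node_algebra\<^esub> x) = cmod c * alg_norm node_algebra x"
    by (simp add: node_norm_scale)
  show "(c \<odot>\<^bsub>node_algebra\<^esub> x) \<otimes>\<^bsub>node_algebra\<^esub> y = c \<odot>\<^bsub>node_algebra\<^esub> (x \<otimes>\<^bsub>node_algebra\<^esub> y)"
    by (simp add: mult_ac)
  show "x \<otimes>\<^bsub>node_algebra\<^esub> (c \<odot>\<^bsub>node_algebra\<^esub> y) = c \<odot>\<^bsub>node_algebra\<^esub> (x \<otimes>\<^bsub>node_algebra\<^esub> y)"
    by (simp add: mult_ac)
  show "alg_norm node_algebra (x \<oplus>\<^bsub>node_algebra\<^esub> y) \<le> alg_norm node_algebra x + alg_norm node_algebra y"
    by (simp add: node_norm_triangle)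
  show "alg_norm node_algebra (x \<otimes>\<^bsub>node_algebra\<^esub> y) \<le> alg_norm node_algebra x * alg_norm node_algebra y"
    by (simp add: node_norm_mult)
qed

lemma node_spectrum:
  assumes "a \<in> range on_nodes"
  shows "spectrum node_algebra a = a ` nodes"
proof -
  have unit: "g \<in> Units node_algebra \<longleftrightarrow> (\<forall>k\<in>nodes. g k \<noteq> 0)" if g: "g \<in> range on_nodes" for g
  proof
    assume "g \<in> Units node_algebra"
    then obtain f where "(\<lambda>r. f r * g r) = on_nodes (\<lambda>_. 1)" by (auto simp: Units_def)
    hence "f k * g k = 1" if "k \<in> nodes" for k using that by (metis on_nodes_simps(1))
    thus "\<forall>k\<in>nodes. g k \<noteq> 0" by force
  next
    assume nz: "\<forall>k\<in>nodes. g k \<noteq> 0"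
    let ?f = "on_nodes (\<lambda>k. inverse (g k))"
    have "(\<lambda>r. ?f r * g r) = on_nodes (\<lambda>_. 1)" "(\<lambda>r. g r * ?f r) = on_nodes (\<lambda>_. 1)"
      using nz by (auto simp: on_nodes_def fun_eq_iff)
    thus "g \<in> Units node_algebra" using g unfolding Units_def by auto
  qed
  have sub: "(z \<odot>\<^bsub>node_algebra\<^esub> \<one>\<^bsub>node_algebra\<^esub>) \<ominus>\<^bsub>node_algebra\<^esub> a = on_nodes (\<lambda>k. z - a k)" for z
    using assms by (subst node_minus) (auto simp: in_range_on_nodes on_nodes_def fun_eq_iff)
  show ?thesis
    unfolding spectrum_def sub using unit by auto
qed

lemma node_pow:
  assumes "x \<in> range on_nodes"
  shows "x [^]\<^bsub>node_algebra\<^esub> (n :: nat) = on_nodes (\<lambda>k. x k ^ n)"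
proof (induction n)
  case (Suc n)
  thus ?case by (auto simp: on_nodes_def fun_eq_iff mult.commute)
qed simp

lemma node_finsum:
  assumes "\<And>i. f i \<in> range on_nodes"
  shows "(\<Oplus>\<^bsub>node_algebra\<^esub>i\<in>{..<n::nat}. f i) = (\<lambda>r. \<Sum>i<n. f i r)"
proof (induction n)
  case (Suc n)
  have "(\<Oplus>\<^bsub>node_algebra\<^esub>i\<in>{..<Suc n}. f i) = f n \<oplus>\<^bsub>node_algebra\<^esub> (\<Oplus>\<^bsub>node_algebra\<^esub>i\<in>{..<n}. f i)"
    unfolding lessThan_Suc using assms by (intro node.finsum_insert) auto
  thus ?case using Suc by (simp add: add.commute)
qed simp

lemma node_exp:
  assumes x: "x \<in> range on_nodes"
  shows "alg_exp node_algebra x = on_nodes (\<lambda>k. exp (x k))"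
proof -
  interpret Metric_space "range on_nodes" "alg_dist node_algebra" by (rule node_Metric_space)
  let ?s = "\<lambda>n::nat. \<Oplus>\<^bsub>node_algebra\<^esub>k\<in>{..<n}. complex_of_real (1 / fact k) \<odot>\<^bsub>node_algebra\<^esub> (x [^]\<^bsub>node_algebra\<^esub> k)"
  have s: "?s n = on_nodes (\<lambda>r. \<Sum>k<n. complex_of_real (1 / fact k) * x r ^ k)" for n
  proof -
    have "?s n = (\<lambda>r. \<Sum>k<n. complex_of_real (1 / fact k) * on_nodes (\<lambda>r. x r ^ k) r)"
      unfolding node_pow[OF x] node_algebra_simps
      by (rule node_finsum) (auto simp: in_range_on_nodes)
    also have "\<dots> = on_nodes (\<lambda>r. \<Sum>k<n. complex_of_real (1 / fact k) * x r ^ k)"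
      by (auto simp: on_nodes_def fun_eq_iff)
    finally show ?thesis .
  qed
  have lim: "limitin mtopology ?s (on_nodes (\<lambda>k. exp (x k))) sequentially"
  proof (rule node_limitin)
    fix k assume k: "k \<in> nodes"
    have "(\<lambda>n. x k ^ n /\<^sub>R fact n) sums exp (x k)" by (rule exp_converges)
    hence "(\<lambda>n. \<Sum>i<n. complex_of_real (1 / fact i) * x k ^ i) \<longlonglongrightarrow> exp (x k)"
      by (simp add: sums_def scaleR_conv_of_real divide_inverse)
    thus "(\<lambda>n. ?s n k) \<longlonglongrightarrow> on_nodes (\<lambda>k. exp (x k)) k" unfolding s using k by simp
  next
    show "?s n \<in> range on_nodes" for n unfolding s by blast
  qed auto
  show ?thesis
    unfolding alg_exp_def node_algebra_simps(1)
  proof (rule the_equality)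
    show "y = on_nodes (\<lambda>k. exp (x k))" if "limitin mtopology ?s y sequentially" for y
      by (rule limitin_metric_unique[OF that lim]) simp
  qed (rule lim)
qed


section \<open>Symbols of the Hermitian element\<close>

lemma node_basis_carrier: "k \<in> nodes \<Longrightarrow> node_basis k \<in> range on_nodes"
  by (auto simp: in_range_on_nodes node_basis_def)

lemma dual_node_algebra_iff:
  "\<phi> \<in> dual node_algebra \<longleftrightarrow>
    (\<forall>x\<in>range on_nodes. \<forall>y\<in>range on_nodes. \<phi> (\<lambda>r. x r + y r) = \<phi> x + \<phi> y) \<and>
    (\<forall>z. \<forall>x\<in>range on_nodes. \<phi> (\<lambda>r. z * x r) = z * \<phi> x) \<and>
    (\<exists>C. \<forall>x\<in>range on_nodes. cmod (\<phi> x) \<le> C * node_norm x)"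
  by (simp only: dual_def node_algebra_simps mem_Collect_eq)

lemma dual_node_algebra_eq:
  assumes \<phi>: "\<phi> \<in> dual node_algebra" and g: "g \<in> range on_nodes"
  shows "\<phi> g = (\<Sum>k\<in>nodes. \<phi> (node_basis k) * g k)"
proof -
  have add: "\<phi> (\<lambda>r. x r + y r) = \<phi> x + \<phi> y" if "x \<in> range on_nodes" "y \<in> range on_nodes" for x y
    using \<phi> that unfolding dual_node_algebra_iff by blast
  have scale: "\<phi> (\<lambda>r. z * x r) = z * \<phi> x" if "x \<in> range on_nodes" for x z
    using \<phi> that unfolding dual_node_algebra_iff by blast
  have "g = (\<lambda>r. (\<lambda>r. g (-1) * node_basis (-1) r + g 0 * node_basis 0 r) r + g 1 * node_basis 1 r)"
    using g by (auto simp: fun_eq_iff in_range_on_nodes node_basis_def nodes_def)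
  hence "\<phi> g = \<phi> (\<lambda>r. (\<lambda>r. g (-1) * node_basis (-1) r + g 0 * node_basis 0 r) r + g 1 * node_basis 1 r)"
    by (rule arg_cong)
  also have "\<dots> = \<phi> (\<lambda>r. g (-1) * node_basis (-1) r + g 0 * node_basis 0 r) + \<phi> (\<lambda>r. g 1 * node_basis 1 r)"
    by (intro add) (auto simp: in_range_on_nodes nodes_def node_basis_def)
  also have "\<phi> (\<lambda>r. g (-1) * node_basis (-1) r + g 0 * node_basis 0 r)
      = \<phi> (\<lambda>r. g (-1) * node_basis (-1) r) + \<phi> (\<lambda>r. g 0 * node_basis 0 r)"
    by (intro add) (auto simp: in_range_on_nodes nodes_def node_basis_def)
  finally show ?thesis
    by (simp add: sum_nodes scale node_basis_carrier nodes_def mult.commute)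
qed

lemma evaluation_in_dual:
  assumes "k \<in> nodes"
  shows "(\<lambda>g. g k) \<in> dual node_algebra"
  unfolding dual_node_algebra_iff
  by (intro conjI ballI allI exI[of _ 1]) (simp_all only: mult_1 cmod_le_node_norm[OF assms])

text \<open>Boundedness of the functional ensures that the supremum in \<^const>\<open>dual_norm\<close> is a genuine one.\<close>

lemma dual_norm_upper:
  assumes \<phi>: "\<phi> \<in> dual node_algebra" and g: "g \<in> range on_nodes" "node_norm g \<le> 1"
  shows "cmod (\<phi> g) \<le> dual_norm node_algebra \<phi>"
proof -
  obtain C where C: "\<And>x. x \<in> range on_nodes \<Longrightarrow> cmod (\<phi> x) \<le> C * node_norm x"
    using \<phi> unfolding dual_node_algebra_iff by blast
  have "bdd_above ((\<lambda>x. cmod (\<phi> x)) ` {x \<in> range on_nodes. node_norm x \<le> 1})"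
  proof (rule bdd_aboveI2)
    fix x assume x: "x \<in> {x \<in> range on_nodes. node_norm x \<le> 1}"
    have "cmod (\<phi> x) \<le> C * node_norm x" using C x by blast
    also have "\<dots> \<le> \<bar>C\<bar> * 1"
      using x node_norm_nonneg[of x] by (intro mult_mono) auto
    finally show "cmod (\<phi> x) \<le> \<bar>C\<bar> * 1" .
  qed
  thus ?thesis unfolding dual_norm_def using g by (intro cSUP_upper2) auto
qed

text \<open>Let \<open>c\<close> be the coefficients of a functional \<open>\<phi>\<close> in the numerical range. As \<open>(e\<^sup>i\<^sup>k\<^sup>t)\<^sub>k\<close> has norm at most
\<open>1\<close>, the real part \<open>u(t)\<close> of \<open>\<Sum> c\<^sub>k e\<^sup>i\<^sup>k\<^sup>t\<close> is at most \<open>1 = u(0)\<close>. Its derivative at \<open>0\<close>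
therefore vanishes, so \<open>\<Sum> k c\<^sub>k\<close> is real, and so is \<open>\<phi> a = y + h \<Sum> k c\<^sub>k\<close>.\<close>

lemma node_hermitian:
  assumes a: "a = on_nodes (\<lambda>k. complex_of_real (y + h * k))"
  shows "a \<in> hermitian node_algebra"
proof -
  have "\<phi> a \<in> \<real>" if \<phi>: "\<phi> \<in> dual node_algebra" "\<phi> \<one>\<^bsub>node_algebra\<^esub> = 1" "dual_norm node_algebra \<phi> = 1" for \<phi>
  proof -
    define c where "c k = \<phi> (node_basis k)" for k
    have rep: "\<phi> (on_nodes g) = c (-1) * g (-1) + c 0 * g 0 + c 1 * g 1" for g
      using dual_node_algebra_eq[OF \<phi>(1), of "on_nodes g"] by (simp add: sum_nodes c_def nodes_def)
    have total: "c (-1) + c 0 + c 1 = 1" using \<phi>(2) by (simp add: rep)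
    define u where "u t = Re (c (-1)) * cos t + Im (c (-1)) * sin t + Re (c 0)
      + Re (c 1) * cos t - Im (c 1) * sin t" for t
    have "u t \<le> u 0" for t
    proof -
      have "u t = Re (\<phi> (on_nodes (\<lambda>k. character k t)))"
        by (simp add: rep u_def character_cis)
      also have "\<dots> \<le> cmod (\<phi> (on_nodes (\<lambda>k. character k t)))" by (rule complex_Re_le_cmod)
      also have "\<dots> \<le> 1"
        using dual_norm_upper[OF \<phi>(1), of "on_nodes (\<lambda>k. character k t)"] node_norm_character \<phi>(3) by simp
      also have "1 = u 0"
        using arg_cong[OF total, of Re] by (simp add: u_def)
      finally show ?thesis .
    qed
    moreover have "(u has_real_derivative Im (c (-1)) - Im (c 1)) (at 0)"
      unfolding u_def[abs_def] by (auto intro!: derivative_eq_intros)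
    ultimately have "Im (c (-1)) - Im (c 1) = 0"
      by (intro DERIV_local_max[of u _ 0 1]) auto
    moreover have "\<phi> a = y * (c (-1) + c 0 + c 1) + h * (c 1 - c (-1))"
      unfolding a rep by (simp add: algebra_simps)
    ultimately have "Im (\<phi> a) = 0" by (simp add: total)
    thus ?thesis by (simp add: complex_is_Real_iff)
  qed
  thus ?thesis unfolding hermitian_def numerical_range_def using a by auto
qed

text \<open>The exponential of \<open>ita\<close> has the values \<open>e\<^sup>i\<^sup>t\<^sup>(\<^sup>y\<^sup>+\<^sup>h\<^sup>k\<^sup>)\<close>, and every functional is a combination of evaluations at the nodes.
So integrating against a measure \<open>\<mu>\<close> gives the transform of \<open>\<mu>\<close> at the points \<open>y + hk\<close>, which is \<open>F\<close> there. The
choice in \<^const>\<open>symbol_apply\<close> is meaningful because some measure represents \<open>F\<close> near all three points.\<close>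

lemma node_symbol_apply:
  assumes F: "F \<in> B_loc" and h: "h \<noteq> 0" and a: "a = on_nodes (\<lambda>k. complex_of_real (y + h * k))"
  shows "symbol_apply node_algebra F a = on_nodes (\<lambda>k. F (y + h * k))"
proof -
  let ?p = "\<lambda>k. y + h * k"
  have a_car: "a \<in> range on_nodes" using a by blast
  have spec: "spectrum node_algebra a = (\<lambda>k. complex_of_real (?p k)) ` nodes"
    by (subst node_spectrum[OF a_car], rule image_cong) (simp_all add: a)
  have "\<exists>\<mu>. represents_near_spectrum node_algebra a F \<mu>"
  proof -
    obtain U G where U: "open U" "?p ` nodes \<subseteq> U" "G \<in> B_alg" "\<forall>\<xi>\<in>U. F \<xi> = G \<xi>"
      using B_loc_near_finite_set[OF F, of "?p ` nodes"] by auto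
    obtain \<mu> where \<mu>: "\<mu> \<in> complex_borel_measures" "G = fourier_stieltjes \<mu>"
      using U(3) unfolding B_alg_def by blast
    have "spectrum node_algebra a \<subseteq> complex_of_real ` U"
      using image_mono[OF U(2), of complex_of_real] unfolding spec by (simp only: image_image)
    thus ?thesis unfolding represents_near_spectrum_def using U(1,4) \<mu> by blast
  qed
  hence "represents_near_spectrum node_algebra a F (SOME \<mu>. represents_near_spectrum node_algebra a F \<mu>)"
    by (rule someI_ex)
  then obtain \<mu> U where \<mu>_eq: "\<mu> = (SOME \<mu>. represents_near_spectrum node_algebra a F \<mu>)"
    and \<mu>: "\<mu> \<in> complex_borel_measures"
    and U: "spectrum node_algebra a \<subseteq> complex_of_real ` U" "\<forall>\<xi>\<in>U. F \<xi> = fourier_stieltjes \<mu> \<xi>"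
    unfolding represents_near_spectrum_def by blast
  have F\<mu>: "complex_integral \<mu> (character (?p k)) = F (?p k)" if "k \<in> nodes" for k
  proof -
    have "complex_of_real (?p k) \<in> complex_of_real ` U" using U(1) that unfolding spec by blast
    hence "?p k \<in> U" by (auto simp del: of_real_add of_real_mult)
    thus ?thesis using U(2) by (simp add: fourier_stieltjes_character)
  qed
  have exp: "alg_exp node_algebra ((\<i> * complex_of_real t) \<odot>\<^bsub>node_algebra\<^esub> a)
      = on_nodes (\<lambda>k. character (?p k) t)" for t
  proof -
    have "(\<i> * complex_of_real t) \<odot>\<^bsub>node_algebra\<^esub> a = on_nodes (\<lambda>k. \<i> * complex_of_real (?p k * t))"
      by (auto simp: a on_nodes_def fun_eq_iff)
    thus ?thesis by (simp add: node_exp) (auto simp: on_nodes_def character_def fun_eq_iff)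
  qed
  let ?b = "on_nodes (\<lambda>k. F (?p k))"
  have integral: "complex_integral \<mu> (\<lambda>t. \<phi> (on_nodes (\<lambda>k. character (?p k) t))) = \<phi> ?b"
    if \<phi>: "\<phi> \<in> dual node_algebra" for \<phi>
  proof -
    note mf = measure_functional_complex_integral[OF \<mu>]
    let ?c = "\<lambda>k. \<phi> (node_basis k)"
    have rep: "\<phi> (on_nodes g) = (\<Sum>k\<in>nodes. ?c k * g k)" for g
      using dual_node_algebra_eq[OF \<phi>, of "on_nodes g"] by simp
    have "complex_integral \<mu> (\<lambda>t. \<Sum>k\<in>nodes. ?c k * character (?p k) t)
        = (\<Sum>k\<in>nodes. complex_integral \<mu> (\<lambda>t. ?c k * character (?p k) t))"
      by (intro measure_functional_sum[OF mf] bounded_borel_scale character_bounded_borel finite_nodes)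
    also have "\<dots> = (\<Sum>k\<in>nodes. ?c k * F (?p k))"
      by (intro sum.cong refl) (simp add: measure_functional_scale[OF mf character_bounded_borel] F\<mu>)
    finally show ?thesis unfolding rep .
  qed
  show ?thesis
    unfolding symbol_apply_def alg_integral_def \<mu>_eq[symmetric] exp
  proof (rule the_equality)
    show "?b \<in> carrier node_algebra \<and> (\<forall>\<phi>\<in>dual node_algebra.
        \<phi> ?b = complex_integral \<mu> (\<lambda>t. \<phi> (on_nodes (\<lambda>k. character (?p k) t))))"
      using integral by simp
  next
    fix b assume b: "b \<in> carrier node_algebra \<and> (\<forall>\<phi>\<in>dual node_algebra.
        \<phi> b = complex_integral \<mu> (\<lambda>t. \<phi> (on_nodes (\<lambda>k. character (?p k) t))))"
    have "b k = ?b k" if "k \<in> nodes" for k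
      using b integral[OF evaluation_in_dual[OF that]] evaluation_in_dual[OF that] by auto
    moreover have "b k = ?b k" if "k \<notin> nodes" for k
      using b that by (simp add: in_range_on_nodes)
    ultimately show "b = ?b" by blast
  qed
qed

text \<open>The norm of \<open>F(a)\<close> is bounded below by the pairing of \<open>node_norm_three_point\<close> and, by universality,
equals the largest of the three moduli.\<close>

lemma universal_symbol_three_point:
  assumes "F \<in> US"
  shows "three_point_inequality (\<lambda>x. cmod (F x))"
  unfolding three_point_inequality_def
proof (intro allI impI)
  fix y h s :: real assume h: "0 < h" and s: "0 \<le> s"
  let ?a = "on_nodes (\<lambda>k. complex_of_real (y + h * k))"
  let ?b = "on_nodes (\<lambda>k. F (y + h * k))"
  let ?M = "max (cmod (F y)) (max (cmod (F (y - h))) (cmod (F (y + h))))"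
  have F: "F \<in> B_loc" "universal_over TYPE(real \<Rightarrow> complex) F"
    using assms by (auto simp: US_def)
  have "alg_norm node_algebra (symbol_apply node_algebra F ?a)
      = spectral_radius node_algebra (symbol_apply node_algebra F ?a)"
    using F(2) node_complex_banach_algebra node_hermitian[OF refl] unfolding universal_over_def by blast
  hence "node_norm ?b = spectral_radius node_algebra ?b"
    using node_symbol_apply[OF F(1) _ refl, of h y] h by simp
  also have "\<dots> \<le> ?M"
    unfolding spectral_radius_def node_spectrum[OF rangeI]
    by (intro cSUP_least) (auto simp: nodes_def)
  finally have "node_norm ?b \<le> ?M" .
  have "cmod (F y) + s * \<bar>cmod (F (y - h)) - cmod (F (y + h))\<bar> \<le> sqrt (1 + 4 * s\<^sup>2) * node_norm ?b"
    using node_norm_three_point[OF s, of ?b] by (simp add: nodes_def)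
  also have "\<dots> \<le> sqrt (1 + 4 * s\<^sup>2) * ?M"
    using \<open>node_norm ?b \<le> ?M\<close> by (rule mult_left_mono) simp
  finally show "cmod (F y) + s * \<bar>cmod (F (y - h)) - cmod (F (y + h))\<bar> \<le> ?M * sqrt (1 + 4 * s\<^sup>2)"
    by (simp add: mult.commute)
qed

theorem theorem2p2:
  fixes F :: "real \<Rightarrow> complex"
  assumes "F \<in> US"
  shows "connected (min_modulus_set F) \<and>
    (min_modulus_set F \<noteq> UNIV \<longrightarrow>
      (\<forall>U \<in> components (UNIV - min_modulus_set F).
        (strict_mono_on U (\<lambda>x. cmod (F x)) \<or> strict_antimono_on U (\<lambda>x. cmod (F x))) \<and>
        \<not> bounded ((\<lambda>x. cmod (F x)) ` U)))"
proof -
  have "continuous_on UNIV (\<lambda>x. cmod (F x))"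
    using assms by (intro continuous_on_norm B_loc_continuous) (simp add: US_def)
  note main = three_point_structure[OF universal_symbol_three_point[OF assms] norm_ge_zero this]
  have compl: "UNIV - min_modulus_set F = {x. cmod (F x) \<noteq> (INF t. cmod (F t))}"
    by (auto simp: min_modulus_set_def)
  have "connected (min_modulus_set F)"
    using main(1) by (simp add: min_modulus_set_def)
  moreover have "(strict_mono_on U (\<lambda>x. cmod (F x)) \<or> strict_antimono_on U (\<lambda>x. cmod (F x))) \<and>
      \<not> bounded ((\<lambda>x. cmod (F x)) ` U)" if "U \<in> components (UNIV - min_modulus_set F)" for U
    using main(2) that unfolding compl by simp
  ultimately show ?thesis by blast
qed

end
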